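(* Let $\mathcal X\subset\mathbb R^d$ be a compact convex set of diameter $D$, let $L>0$, $\gamma\in(0,1]$, $\epsilon>0$, and let $f:\mathbb R^d\to\mathbb R$ be $L$-smooth in $\mathcal X$ and $\gamma$-quasar convex in $\mathcal X$ with center $x^\ast\in\mathcal X$. Then Algorithm A (described in the context), started at any $x_0\in\mathcal X$, outputs a point $\hat y_T\in\mathcal X$ which is an $\epsilon$-minimizer, i.e. $f(\hat y_T)-\min_{x\in\mathcal X}f(x)\le\epsilon$, using $$\widetilde O\left(\frac1\gamma\sqrt{\frac{LD^2}{\epsilon}}\right)$$ queries to a first-order oracle of $f$.
   Context: **Definitions.** A function is differentiable on a closed set $\mathcal X$ if it is differentiable in an open neighborhood of $\mathcal X$. A differentiable $f$ is $L$-smooth in $\mathcal X$ if $\|\nabla f(x)-\nabla f(y)\|_2\le L\|x-y\|_2$ for all $x,y\in\mathcal X$. For $\gamma\in(0,1]$, $f$ is $\gamma$-quasar convex in $\mathcal X$ with center $x^\ast\in\mathcal X$ if $x^\ast\in\arg\min_{x\in\mathcal X}f(x)$ and $f(x^\ast)\ge f(x)+\frac1\gamma\langle\nabla f(x),x^\ast-x\rangle$ for all $x\in\mathcal X$. A first-order oracle for $f$ returns $(f(x),\nabla f(x))$ at a query point $x$. $\widetilde O(\cdot)$ is big-O notation omitting logarithmic factors: $q=\widetilde O(B)$ means $q\le C\max\{1,B\}\log^k(2+LD^2/\epsilon+1/\gamma)$ for absolute constants $C,k$. **Proximal quantities.** Put $\lambda=1/(2L)$, $T=\left\lceil\frac4\gamma\sqrt{LD^2/\epsilon}\right\rceil$,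 $\delta=LD^2/(10T^6)$. A $\delta$-minimizer of a function $F$ over $\mathcal X$ is a point $y\in\mathcal X$ with $F(y)\le\min_{\mathcal X}F+\delta$. For $x\in\mathcal X$ let $y_x$ be a $\delta$-minimizer over $\mathcal X$ of $y\mapsto f(y)+\frac1{2\lambda}\|y-x\|_2^2$ (the same choice being used each time the point $x$ occurs), and let $\widetilde M(x)=f(y_x)+\frac1{2\lambda}\|y_x-x\|_2^2$ and $\widetilde\nabla M(x)=\frac1\lambda(x-y_x)$. Each such $\delta$-minimizer is computed by projected gradient descent on the subproblem objective $F(y)=f(y)+\frac1{2\lambda}\|y-x\|_2^2$, i.e. by iterating $y\leftarrow\operatorname{Proj}_{\mathcal X}(y-\eta\nabla F(y))$ with $\eta=1/(3L)$ from a point of $\mathcal X$, for a number $O(\log(LD^2/\delta))$ of iterations sufficient to guarantee a $\delta$-minimizer. **Algorithm A.** Set $y_0=z_0=x_0$, $A_0=0$. For $t=1,\dots,T$: 1. $a_t=\gamma^2t/(8L)$, $A_t=\sum_{i=1}^ta_i=\gamma^2t(t+1)/(16L)$. 2. $x_t=\operatorname{BinaryLineSearch}(y_{t-1},z_{t-1},c)$ with $c=A_{t-1}\gamma/a_t$. 3. $y_t=y_{x_t}$ and $\widetilde\nabla M(x_t)=\frac1\lambda(x_t-y_t)$. 4. $z_t=\arg\min_{z\in\mathcal X}\left\{\sum_{i=1}^t\frac{a_i}\gamma\langle\widetilde\nabla M(x_i),z\rangle+\frac12\|z-x_0\|_2^2\right\}$. Return $\hat y_T$, a $\delta$-minimizer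 over $\mathcal X$ of $y\mapsto f(y)+\frac1{2\lambda}\|y_T-y\|_2^2$. **BinaryLineSearch$(y,z,c)$**, for $y,z\in\mathcal X$, $c\ge0$. Let $v_\alpha=\alpha y+(1-\alpha)z$, $h(\alpha)=\widetilde M(v_\alpha)$, $\hat h(\alpha)=\langle\widetilde\nabla M(v_\alpha),y-z\rangle$, $\delta_1=\delta$, $\delta_2=\sqrt{8L\delta}\,\|y-z\|_2$, $\tilde\epsilon=\delta_2+(9+5c)\delta_1$. - If $\hat h(1)\le\tilde\epsilon$, return $v_1=y$. - Else if $h(1)-h(0)\ge-\delta_1$, return $v_0=z$. - Else set $a=0$, $b=1$, $\alpha=1/2$. While $\alpha\hat h(\alpha)>c(h(1)-h(\alpha))+\tilde\epsilon$: if $h(\alpha)\ge h(1)-\delta_1$ set $a\leftarrow\alpha$, otherwise set $b\leftarrow\alpha$; then set $\alpha\leftarrow(a+b)/2$. Return $v_\alpha$. *)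

theory Defs
  imports "HOL-Analysis.Analysis" "HOL-Library.Poly_Mapping"
begin

section \<open>Euclidean spaces of all dimensions inside one type\<close>

text \<open>
  The complexity bound has constants that do not depend on the dimension, so the dimension has to be
  quantified inside the scope of these constants. It therefore cannot be a type parameter. All the
  spaces \<open>\<real>\<^sup>d\<close> are represented as the coordinate subspaces of the finitely supported real sequences,
  which carry the usual inner product.
\<close>

instantiation poly_mapping :: (type, real_inner) real_inner
begin

lift_definition scaleR_poly_mapping :: "real \<Rightarrow> ('a \<Rightarrow>\<^sub>0 'b) \<Rightarrow> 'a \<Rightarrow>\<^sub>0 'b"
  is "\<lambda>c x k. c *\<^sub>R x k"
  by (rule finite_subset[rotated]) auto

definition inner_poly_mapping :: "('a \<Rightarrow>\<^sub>0 'b) \<Rightarrow> ('a \<Rightarrow>\<^sub>0 'b) \<Rightarrow> real" where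
  "inner_poly_mapping x y = (\<Sum>k\<in>Poly_Mapping.keys x. Poly_Mapping.lookup x k \<bullet> Poly_Mapping.lookup y k)"

definition norm_poly_mapping :: "('a \<Rightarrow>\<^sub>0 'b) \<Rightarrow> real" where
  "norm_poly_mapping x = sqrt (x \<bullet> x)"

definition dist_poly_mapping :: "('a \<Rightarrow>\<^sub>0 'b) \<Rightarrow> ('a \<Rightarrow>\<^sub>0 'b) \<Rightarrow> real" where
  "dist_poly_mapping x y = norm (x - y)"

definition sgn_poly_mapping :: "('a \<Rightarrow>\<^sub>0 'b) \<Rightarrow> 'a \<Rightarrow>\<^sub>0 'b" where
  "sgn_poly_mapping x = inverse (norm x) *\<^sub>R x"

definition uniformity_poly_mapping :: "(('a \<Rightarrow>\<^sub>0 'b) \<times> ('a \<Rightarrow>\<^sub>0 'b)) filter" where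
  "uniformity_poly_mapping = (INF e\<in>{0 <..}. principal {(x, y). dist x y < e})"

definition open_poly_mapping :: "('a \<Rightarrow>\<^sub>0 'b) set \<Rightarrow> bool" where
  "open_poly_mapping U \<longleftrightarrow> (\<forall>x\<in>U. eventually (\<lambda>(x', y). x' = x \<longrightarrow> y \<in> U) uniformity)"

lemma inner_poly_mapping_superset:
  fixes x y :: "'a \<Rightarrow>\<^sub>0 'b"
  assumes "finite S" "Poly_Mapping.keys x \<subseteq> S"
  shows "x \<bullet> y = (\<Sum>k\<in>S. Poly_Mapping.lookup x k \<bullet> Poly_Mapping.lookup y k)"
  unfolding inner_poly_mapping_def
  by (rule sum.mono_neutral_left) (use assms in \<open>auto simp: in_keys_iff\<close>)

instance
proof
  fix x y z :: "'a \<Rightarrow>\<^sub>0 'b" and a b :: real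
  show "a *\<^sub>R (x + y) = a *\<^sub>R x + a *\<^sub>R y"
    by transfer (simp add: scaleR_add_right)
  show "(a + b) *\<^sub>R x = a *\<^sub>R x + b *\<^sub>R x"
    by transfer (simp add: scaleR_add_left)
  show "a *\<^sub>R b *\<^sub>R x = (a * b) *\<^sub>R x"
    by transfer simp
  show "1 *\<^sub>R x = x"
    by transfer simp
  show "x \<bullet> y = y \<bullet> x"
    using inner_poly_mapping_superset[of "Poly_Mapping.keys x \<union> Poly_Mapping.keys y" x y]
      inner_poly_mapping_superset[of "Poly_Mapping.keys x \<union> Poly_Mapping.keys y" y x]
    by (simp add: inner_commute)
  show "(x + y) \<bullet> z = x \<bullet> z + y \<bullet> z"
    using inner_poly_mapping_superset[of "Poly_Mapping.keys x \<union> Poly_Mapping.keys y" x z]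
      inner_poly_mapping_superset[of "Poly_Mapping.keys x \<union> Poly_Mapping.keys y" y z]
      inner_poly_mapping_superset[of "Poly_Mapping.keys x \<union> Poly_Mapping.keys y" "x + y" z]
      Poly_Mapping.keys_add[of x y]
    by (simp add: lookup_add inner_add_left sum.distrib)
  show "(a *\<^sub>R x) \<bullet> y = a * (x \<bullet> y)"
    using inner_poly_mapping_superset[of "Poly_Mapping.keys x" x y]
      inner_poly_mapping_superset[of "Poly_Mapping.keys x" "a *\<^sub>R x" y]
    by (simp add: scaleR_poly_mapping.rep_eq sum_distrib_left in_keys_iff subset_iff)
  show "0 \<le> x \<bullet> x"
    unfolding inner_poly_mapping_def by (simp add: sum_nonneg)
  show "x \<bullet> x = 0 \<longleftrightarrow> x = 0"
    unfolding inner_poly_mapping_def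
    by (subst sum_nonneg_eq_0_iff) (auto simp: in_keys_iff intro: poly_mapping_eqI)
qed (simp_all add: norm_poly_mapping_def dist_poly_mapping_def sgn_poly_mapping_def
      uniformity_poly_mapping_def open_poly_mapping_def)

end

type_synonym rvec = "nat \<Rightarrow>\<^sub>0 real"

definition euclid :: "nat \<Rightarrow> rvec set" where
  "euclid d = {x. Poly_Mapping.keys x \<subseteq> {..<d}}"


section \<open>Smoothness and quasar convexity\<close>

text \<open>
  A function on \<open>\<real>\<^sup>d\<close> is a function \<open>rvec \<Rightarrow> real\<close> whose values outside \<open>euclid d\<close> are irrelevant.
  Derivatives are taken within \<open>euclid d\<close>, and neighbourhoods are relative to \<open>euclid d\<close>.
\<close>

definition grad :: "nat \<Rightarrow> (rvec \<Rightarrow> real) \<Rightarrow> rvec \<Rightarrow> rvec" where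
  "grad d f x =
    (THE g. g \<in> euclid d \<and> (f has_derivative (\<lambda>h. g \<bullet> h)) (at x within euclid d))"

definition differentiable_near :: "nat \<Rightarrow> (rvec \<Rightarrow> real) \<Rightarrow> rvec set \<Rightarrow> bool" where
  "differentiable_near d f X \<longleftrightarrow>
    (\<exists>U. open U \<and> X \<subseteq> U \<and> f differentiable_on (U \<inter> euclid d))"

definition smooth_in :: "nat \<Rightarrow> real \<Rightarrow> (rvec \<Rightarrow> real) \<Rightarrow> rvec set \<Rightarrow> bool" where
  "smooth_in d L f X \<longleftrightarrow>
    differentiable_near d f X \<and>
    (\<forall>x\<in>X. \<forall>y\<in>X. norm (grad d f x - grad d f y) \<le> L * norm (x - y))"

definition quasar_convex_in ::
    "nat \<Rightarrow> real \<Rightarrow> (rvec \<Rightarrow> real) \<Rightarrow> rvec set \<Rightarrow> rvec \<Rightarrow> bool" where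
  "quasar_convex_in d \<gamma> f X xs \<longleftrightarrow>
    differentiable_near d f X \<and> 0 < \<gamma> \<and> \<gamma> \<le> 1 \<and>
    is_arg_min f (\<lambda>x. x \<in> X) xs \<and>
    (\<forall>x\<in>X. f xs \<ge> f x + 1 / \<gamma> * (grad d f x \<bullet> (xs - x)))"

definition approx_minimizer :: "real \<Rightarrow> (rvec \<Rightarrow> real) \<Rightarrow> rvec set \<Rightarrow> rvec \<Rightarrow> bool" where
  "approx_minimizer \<epsilon> F X y \<longleftrightarrow> y \<in> X \<and> F y \<le> (INF x\<in>X. F x) + \<epsilon>"


section \<open>Computations with a first-order oracle\<close>

text \<open>
  A computation is run on an oracle and yields its result together with the number of oracle queries
  made, or \<^term>\<open>None\<close> if it does not terminate. The algorithms below are not given the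
  objective function; they only access it through \<open>query\<close>.
\<close>

type_synonym oracle_fun = "rvec \<Rightarrow> real \<times> rvec"
type_synonym 'a comp = "oracle_fun \<Rightarrow> ('a \<times> nat) option"

definition first_order_oracle :: "nat \<Rightarrow> (rvec \<Rightarrow> real) \<Rightarrow> oracle_fun" where
  "first_order_oracle d f x = (f x, grad d f x)"

definition query :: "rvec \<Rightarrow> (real \<times> rvec) comp" where
  "query x = (\<lambda>orc. Some (orc x, 1))"

definition ret :: "'a \<Rightarrow> 'a comp" where
  "ret v = (\<lambda>orc. Some (v, 0))"

definition bind_comp :: "'a comp \<Rightarrow> ('a \<Rightarrow> 'b comp) \<Rightarrow> 'b comp" (infixl \<open>\<rhd>\<close> 54) where
  "m \<rhd> k = (\<lambda>orc. case m orc of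
      None \<Rightarrow> None
    | Some (v, n) \<Rightarrow> (case k v orc of None \<Rightarrow> None | Some (w, n') \<Rightarrow> Some (w, n + n')))"

text \<open>
  Unbounded iteration: \<open>Inl\<close> continues with a new state, \<open>Inr\<close> stops with a result.
\<close>

partial_function (option) iterate :: "('s \<Rightarrow> ('s + 'r) comp) \<Rightarrow> 's \<Rightarrow> 'r comp" where
  "iterate step s orc =
    Option.bind (step s orc) (\<lambda>(r, n).
      case r of
        Inr v \<Rightarrow> Some (v, n)
      | Inl s' \<Rightarrow> Option.bind (iterate step s' orc) (\<lambda>(v, n'). Some (v, n + n')))"


section \<open>Proximal subproblems\<close>

definition lam :: "real \<Rightarrow> real" where
  "lam L = 1 / (2 * L)"

definition num_rounds :: "real \<Rightarrow> real \<Rightarrow> real \<Rightarrow> real \<Rightarrow> nat" where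
  "num_rounds L \<gamma> \<epsilon> D = nat \<lceil>4 / \<gamma> * sqrt (L * D\<^sup>2 / \<epsilon>)\<rceil>"

definition tol :: "real \<Rightarrow> real \<Rightarrow> real \<Rightarrow> real \<Rightarrow> real" where
  "tol L \<gamma> \<epsilon> D = L * D\<^sup>2 / (10 * real (num_rounds L \<gamma> \<epsilon> D) ^ 6)"

definition prox_objective :: "real \<Rightarrow> (rvec \<Rightarrow> real) \<Rightarrow> rvec \<Rightarrow> rvec \<Rightarrow> real" where
  "prox_objective L f x y = f y + 1 / (2 * lam L) * (norm (y - x))\<^sup>2"

definition proj :: "rvec set \<Rightarrow> rvec \<Rightarrow> rvec" where
  "proj X v = arg_min_on (\<lambda>p. norm (p - v)) X"

fun pgd :: "rvec set \<Rightarrow> real \<Rightarrow> nat \<Rightarrow> rvec \<Rightarrow> rvec \<Rightarrow> rvec comp" where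
  "pgd X L 0 x y = ret y"
| "pgd X L (Suc n) x y =
    query y \<rhd> (\<lambda>(_, g).
      pgd X L n x (proj X (y - (1 / (3 * L)) *\<^sub>R (g + (1 / lam L) *\<^sub>R (y - x)))))"

text \<open>
  \<open>N\<close> is a number of iterations that is at most \<open>K * ln (L D\<^sup>2 / \<delta>)\<close> and guarantees a
  \<open>\<delta>\<close>-minimizer for every subproblem and every starting point.
  If \<open>D > 0\<close> then \<open>L D\<^sup>2 / \<delta> \<ge> 10\<close>. If \<open>D = 0\<close> then \<open>\<delta> = 0\<close>, and the bound is \<open>0\<close> by the conventions
  for division and \<^const>\<open>ln\<close> at zero, which is sufficient as the feasible set is a single point.
\<close>

definition sufficient_iterations ::
    "real \<Rightarrow> nat \<Rightarrow> (rvec \<Rightarrow> real) \<Rightarrow> rvec set \<Rightarrow> real \<Rightarrow> real \<Rightarrow> real \<Rightarrow> nat \<Rightarrow> bool" where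
  "sufficient_iterations K d f X L D \<delta> N \<longleftrightarrow>
    real N \<le> K * ln (L * D\<^sup>2 / \<delta>) \<and>
    (\<forall>x\<in>X. \<forall>y0\<in>X. \<exists>y n.
       pgd X L N x y0 (first_order_oracle d f) = Some (y, n) \<and>
       approx_minimizer \<delta> (prox_objective L f x) X y)"

text \<open>
  \<open>s x\<close> is the starting point of projected gradient descent for the subproblem at \<open>x\<close>; that it
  is a function of \<open>x\<close> makes \<open>y\<^sub>x\<close> the same point each time \<open>x\<close> occurs.
\<close>

definition prox_point ::
    "rvec set \<Rightarrow> real \<Rightarrow> nat \<Rightarrow> (rvec \<Rightarrow> rvec) \<Rightarrow> rvec \<Rightarrow> rvec comp" where
  "prox_point X L N s x = pgd X L N x (s x)"

definition approx_moreau ::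
    "rvec set \<Rightarrow> real \<Rightarrow> nat \<Rightarrow> (rvec \<Rightarrow> rvec) \<Rightarrow> rvec \<Rightarrow> (real \<times> rvec) comp" where
  "approx_moreau X L N s x =
    prox_point X L N s x \<rhd> (\<lambda>y.
    query y \<rhd> (\<lambda>(fy, _).
    ret (fy + 1 / (2 * lam L) * (norm (y - x))\<^sup>2, (1 / lam L) *\<^sub>R (x - y))))"


section \<open>Binary line search\<close>

definition segment_point :: "rvec \<Rightarrow> rvec \<Rightarrow> real \<Rightarrow> rvec" where
  "segment_point y z \<alpha> = \<alpha> *\<^sub>R y + (1 - \<alpha>) *\<^sub>R z"

definition line_search_tol :: "real \<Rightarrow> real \<Rightarrow> rvec \<Rightarrow> rvec \<Rightarrow> real \<Rightarrow> real" where
  "line_search_tol L \<delta> y z c = sqrt (8 * L * \<delta>) * norm (y - z) + (9 + 5 * c) * \<delta>"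

definition line_search_step ::
    "rvec set \<Rightarrow> real \<Rightarrow> real \<Rightarrow> nat \<Rightarrow> (rvec \<Rightarrow> rvec) \<Rightarrow> rvec \<Rightarrow> rvec \<Rightarrow> real \<Rightarrow> real \<Rightarrow>
     real \<times> real \<times> real \<Rightarrow> ((real \<times> real \<times> real) + rvec) comp" where
  "line_search_step X L \<delta> N s y z c h1 = (\<lambda>(a, b, \<alpha>).
    approx_moreau X L N s (segment_point y z \<alpha>) \<rhd> (\<lambda>(h\<alpha>, g\<alpha>).
    ret (if \<alpha> * (g\<alpha> \<bullet> (y - z)) > c * (h1 - h\<alpha>) + line_search_tol L \<delta> y z c
         then if h\<alpha> \<ge> h1 - \<delta> then Inl (\<alpha>, b, (\<alpha> + b) / 2) else Inl (a, \<alpha>, (a + \<alpha>) / 2)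
         else Inr (segment_point y z \<alpha>))))"

definition binary_line_search ::
    "rvec set \<Rightarrow> real \<Rightarrow> real \<Rightarrow> nat \<Rightarrow> (rvec \<Rightarrow> rvec) \<Rightarrow> rvec \<Rightarrow> rvec \<Rightarrow> real \<Rightarrow> rvec comp" where
  "binary_line_search X L \<delta> N s y z c =
    approx_moreau X L N s (segment_point y z 1) \<rhd> (\<lambda>(h1, g1).
    if g1 \<bullet> (y - z) \<le> line_search_tol L \<delta> y z c then ret (segment_point y z 1)
    else approx_moreau X L N s (segment_point y z 0) \<rhd> (\<lambda>(h0, _).
      if h1 - h0 \<ge> - \<delta> then ret (segment_point y z 0)
      else iterate (line_search_step X L \<delta> N s y z c h1) (0, 1, 1 / 2)))"


section \<open>The accelerated method\<close>

definition weight :: "real \<Rightarrow> real \<Rightarrow> nat \<Rightarrow> real" where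
  "weight L \<gamma> t = \<gamma>\<^sup>2 * real t / (8 * L)"

definition weight_sum :: "real \<Rightarrow> real \<Rightarrow> nat \<Rightarrow> real" where
  "weight_sum L \<gamma> t = (\<Sum>i=1..t. weight L \<gamma> i)"

text \<open>
  \<open>rounds t\<close> computes \<open>(y\<^sub>t, z\<^sub>t, G)\<close>, where \<open>G i\<close> is the approximate gradient at \<open>x\<^sub>i\<close> for
  \<open>1 \<le> i \<le> t\<close>.
\<close>

fun rounds ::
    "rvec set \<Rightarrow> real \<Rightarrow> real \<Rightarrow> real \<Rightarrow> nat \<Rightarrow> (rvec \<Rightarrow> rvec) \<Rightarrow> rvec \<Rightarrow> nat \<Rightarrow>
     (rvec \<times> rvec \<times> (nat \<Rightarrow> rvec)) comp" where
  "rounds X L \<gamma> \<delta> N s x0 0 = ret (x0, x0, \<lambda>_. 0)"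
| "rounds X L \<gamma> \<delta> N s x0 (Suc k) =
    rounds X L \<gamma> \<delta> N s x0 k \<rhd> (\<lambda>(y, z, G).
    binary_line_search X L \<delta> N s y z (weight_sum L \<gamma> k * \<gamma> / weight L \<gamma> (Suc k)) \<rhd> (\<lambda>x.
    prox_point X L N s x \<rhd> (\<lambda>y'.
    let G' = G(Suc k := (1 / lam L) *\<^sub>R (x - y'));
        z' = arg_min_on (\<lambda>w. (\<Sum>i=1..Suc k. weight L \<gamma> i / \<gamma> * (G' i \<bullet> w))
                             + 1 / 2 * (norm (w - x0))\<^sup>2) X
    in ret (y', z', G'))))"

text \<open>The starting point \<open>u\<close> of the final subproblem solve may differ from \<open>s y\<^sub>T\<close>.\<close>

definition algorithm_A ::
    "rvec set \<Rightarrow> real \<Rightarrow> real \<Rightarrow> real \<Rightarrow> real \<Rightarrow> nat \<Rightarrow> (rvec \<Rightarrow> rvec) \<Rightarrow> rvec \<Rightarrow> rvec \<Rightarrow>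
     rvec comp" where
  "algorithm_A X D L \<gamma> \<epsilon> N s u x0 =
    rounds X L \<gamma> (tol L \<gamma> \<epsilon> D) N s x0 (num_rounds L \<gamma> \<epsilon> D) \<rhd> (\<lambda>(y, _, _).
    pgd X L N y u)"

end

(*
  Write y_x for the delta-minimizer of the subproblem at x, h(x) for its value and
  G(x) = 2L (x - y_x). Using y_x as a test point for the subproblem at x' gives the model
  h(x') <= h(x) + delta + <G(x), x' - x> + L |x' - x|^2. The model alone forces the line search to
  stop: at a bracket [a, b] whose width is of order sqrt(delta/L) / |y - z|, the steep slope
  at b contradicts the value at a, and the range of excluded widths cannot be jumped over by
  halving. As 1/delta is polynomial in T, this leaves O(log T) bisections.

  Optimality of the exact proximal point transfers quasar convexity from f to the Moreau envelope,
  up to an error sqrt(8 L delta) D / gamma. With the line search inequality and the strong convexity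
  of the dual averaging objective psi_t, this gives
    A_t (f(y_t) - f_min) <= psi_t(z_t) - sum_{i<=t} a_i/gamma <G(x_i), xs> + A_t * (small error),
  and psi_T(z_T) <= psi_T(xs) at the minimizer xs yields f(y_T) - f_min <= D^2 / (2 A_T) + small error.
*)

theory Submission
  imports Defs
begin

section \<open>Gradients on coordinate subspaces and minimizers over convex sets\<close>

lemma subspace_euclid: "subspace (euclid d)"
proof (rule subspaceI)
  show "0 \<in> euclid d"
    by (simp add: euclid_def)
next
  fix x y assume "x \<in> euclid d" "y \<in> euclid d"
  then show "x + y \<in> euclid d"
    using Poly_Mapping.keys_add[of x y] by (auto simp: euclid_def)
next
  fix c x assume "x \<in> euclid d"
  then show "c *\<^sub>R x \<in> euclid d"
    by (auto simp: euclid_def in_keys_iff scaleR_poly_mapping.rep_eq subset_iff)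
qed

lemma single_mem_euclid: "i < d \<Longrightarrow> Poly_Mapping.single i c \<in> euclid d"
  by (simp add: euclid_def)

lemma euclid_basis_expansion:
  assumes "x \<in> euclid d"
  shows "x = (\<Sum>i<d. Poly_Mapping.lookup x i *\<^sub>R Poly_Mapping.single i 1)"
proof (rule poly_mapping_eqI)
  fix k
  have "Poly_Mapping.lookup x k = 0" if "\<not> k < d"
    using assms that by (auto simp: euclid_def in_keys_iff subset_iff)
  then show "Poly_Mapping.lookup x k =
      Poly_Mapping.lookup (\<Sum>i<d. Poly_Mapping.lookup x i *\<^sub>R Poly_Mapping.single i 1) k"
    by (simp add: lookup_sum scaleR_poly_mapping.rep_eq lookup_single when_def if_distrib
        cong: if_cong)
qed

lemma inner_single: "Poly_Mapping.single i (1::real) \<bullet> x = Poly_Mapping.lookup x i"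
  using inner_poly_mapping_superset[of "{i}" "Poly_Mapping.single i (1::real)" x] by simp

lemma has_derivative_along_line:
  fixes x v :: "'a::real_inner"
  assumes "(f has_derivative (\<lambda>h. g \<bullet> h)) (at (x + t *\<^sub>R v) within S)"
    and "\<And>s. s \<in> T \<Longrightarrow> x + s *\<^sub>R v \<in> S"
  shows "((\<lambda>s. f (x + s *\<^sub>R v)) has_real_derivative (g \<bullet> v)) (at t within T)"
proof -
  have "((\<lambda>s. x + s *\<^sub>R v) has_derivative (\<lambda>s. s *\<^sub>R v)) (at t within T)"
    by (auto intro!: derivative_eq_intros)
  moreover have "(f has_derivative (\<lambda>h. g \<bullet> h))
      (at (x + t *\<^sub>R v) within (\<lambda>s. x + s *\<^sub>R v) ` T)"
    by (rule has_derivative_subset[OF assms(1)]) (use assms(2) in auto)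
  ultimately have "((\<lambda>s. f (x + s *\<^sub>R v)) has_derivative (\<lambda>s. g \<bullet> (s *\<^sub>R v))) (at t within T)"
    by (rule has_derivative_in_compose)
  then show ?thesis
    by (simp add: has_field_derivative_def mult_commute_abs)
qed

text \<open>\<open>grad\<close> is a definite description, so nothing follows from it before
  existence and uniqueness are known. Existence comes from the coordinates of the derivative in the
  basis of \<open>euclid d\<close>. Uniqueness holds because the difference of two candidates is
  itself a direction of \<open>euclid d\<close>.\<close>

lemma grad_works:
  assumes diff: "f differentiable (at x within euclid d)" and x: "x \<in> euclid d"
  shows "grad d f x \<in> euclid d"
    and "(f has_derivative (\<lambda>h. grad d f x \<bullet> h)) (at x within euclid d)"
proof -
  note sub = subspace_add[OF subspace_euclid] subspace_scale[OF subspace_euclid]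
    subspace_diff[OF subspace_euclid] subspace_sum[OF subspace_euclid]
  obtain f' where f': "(f has_derivative f') (at x within euclid d)"
    using diff by (auto simp: differentiable_def)
  then have lin: "linear f'"
    using has_derivative_linear by blast
  define g where "g = (\<Sum>i<d. f' (Poly_Mapping.single i 1) *\<^sub>R Poly_Mapping.single i (1::real))"
  have g: "g \<in> euclid d"
    unfolding g_def by (intro sub single_mem_euclid) auto
  have f'_eq: "f' h = g \<bullet> h" if "h \<in> euclid d" for h
  proof -
    have "f' h = f' (\<Sum>i<d. Poly_Mapping.lookup h i *\<^sub>R Poly_Mapping.single i 1)"
      by (rule arg_cong[OF euclid_basis_expansion[OF that]])
    also have "\<dots> = (\<Sum>i<d. Poly_Mapping.lookup h i * f' (Poly_Mapping.single i 1))"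
      by (simp add: linear_sum[OF lin] linear_scale[OF lin])
    also have "\<dots> = g \<bullet> h"
      by (simp add: g_def inner_sum_left inner_single mult.commute)
    finally show ?thesis .
  qed
  \<comment> \<open>\<open>f'\<close> and the inner product with \<open>g\<close> may differ outside
    \<open>euclid d\<close>, but the limit only visits points of \<open>euclid d\<close>.\<close>
  have der: "(f has_derivative (\<lambda>h. g \<bullet> h)) (at x within euclid d)"
    unfolding has_derivative_within
  proof
    show "bounded_linear ((\<bullet>) g)"
      by (rule bounded_linear_inner_right)
    have "((\<lambda>y. (1 / norm (y - x)) *\<^sub>R (f y - (f x + f' (y - x)))) \<longlongrightarrow> 0) (at x within euclid d)"
      using f' by (simp add: has_derivative_within)
    then show "((\<lambda>y. (1 / norm (y - x)) *\<^sub>R (f y - (f x + g \<bullet> (y - x)))) \<longlongrightarrow> 0) (at x within euclid d)"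
      by (rule Lim_transform_within[where d = 1]) (use x in \<open>auto simp: f'_eq sub\<close>)
  qed
  have uniq: "g' = g" if "g' \<in> euclid d"
    and "(f has_derivative (\<lambda>h. g' \<bullet> h)) (at x within euclid d)" for g'
  proof -
    have "((\<lambda>s. f (x + s *\<^sub>R (g' - g))) has_real_derivative k \<bullet> (g' - g)) (at 0)"
      if "(f has_derivative (\<lambda>h. k \<bullet> h)) (at x within euclid d)" for k
      by (rule has_derivative_along_line[where S = "euclid d"])
        (use that x g \<open>g' \<in> euclid d\<close> in \<open>auto intro!: sub\<close>)
    from DERIV_unique[OF this this] have "g' \<bullet> (g' - g) = g \<bullet> (g' - g)"
      using der that(2) by blast
    then have "(g' - g) \<bullet> (g' - g) = 0"
      by (simp add: inner_diff_left)
    then show ?thesis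
      by simp
  qed
  have "grad d f x \<in> euclid d \<and> (f has_derivative (\<lambda>h. grad d f x \<bullet> h)) (at x within euclid d)"
    unfolding grad_def by (rule theI[of _ g]) (use g der in \<open>blast intro: uniq\<close>)+
  then show "grad d f x \<in> euclid d"
    "(f has_derivative (\<lambda>h. grad d f x \<bullet> h)) (at x within euclid d)"
    by auto
qed

text \<open>Compare \<open>p\<close> with the point \<open>(1 - t) p + t w\<close>, divide by
  \<open>t\<close> and let \<open>t\<close> tend to 0. Both the projection and dual averaging are
  instances.\<close>

lemma minimizer_quadratic:
  fixes b :: real and v g p w :: "'a::real_inner"
  defines "\<Phi> \<equiv> \<lambda>w. g \<bullet> w + b / 2 * (norm (w - v))\<^sup>2"
  assumes "convex X" "p \<in> X" "w \<in> X" and min: "\<And>w. w \<in> X \<Longrightarrow> \<Phi> p \<le> \<Phi> w"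
  shows "\<Phi> p + b / 2 * (norm (w - p))\<^sup>2 \<le> \<Phi> w"
proof -
  have ineq: "b / 2 * (norm (w - p))\<^sup>2 * (1 - t) \<le> \<Phi> w - \<Phi> p" if t: "0 < t" "t \<le> 1" for t
  proof -
    have "(1 - t) *\<^sub>R p + t *\<^sub>R w \<in> X"
      using assms(2-4) t by (intro convexD) auto
    then have "\<Phi> p \<le> \<Phi> ((1 - t) *\<^sub>R p + t *\<^sub>R w)"
      by (rule min)
    also have "\<dots> = \<Phi> p + t * (\<Phi> w - \<Phi> p) - b / 2 * t * (1 - t) * (norm (w - p))\<^sup>2"
      unfolding \<Phi>_def power2_norm_eq_inner
      by (simp add: inner_simps inner_commute field_simps)
    finally have "t * (b / 2 * (norm (w - p))\<^sup>2 * (1 - t)) \<le> t * (\<Phi> w - \<Phi> p)"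
      by (simp add: algebra_simps)
    then show ?thesis
      using t by simp
  qed
  have "((\<lambda>t. b / 2 * (norm (w - p))\<^sup>2 * (1 - t)) \<longlongrightarrow> b / 2 * (norm (w - p))\<^sup>2 * (1 - 0)) (at_right 0)"
    by (intro tendsto_intros)
  moreover have "eventually (\<lambda>t. b / 2 * (norm (w - p))\<^sup>2 * (1 - t) \<le> \<Phi> w - \<Phi> p) (at_right 0)"
    unfolding eventually_at_right[OF zero_less_one] using ineq by (intro exI[of _ 1]) auto
  ultimately have "b / 2 * (norm (w - p))\<^sup>2 * (1 - 0) \<le> \<Phi> w - \<Phi> p"
    by (intro tendsto_upperbound) auto
  then show ?thesis
    by simp
qed

section \<open>Existence of minimizers and the metric projection\<close>

lemma arg_min_on_compact:
  fixes F :: "'a::topological_space \<Rightarrow> real"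
  assumes "compact X" "X \<noteq> {}" "continuous_on X F"
  shows "arg_min_on F X \<in> X" "w \<in> X \<Longrightarrow> F (arg_min_on F X) \<le> F w"
proof -
  obtain p where "is_arg_min F (\<lambda>x. x \<in> X) p"
    using continuous_attains_inf[OF assms] by (auto simp: is_arg_min_linorder)
  then have "is_arg_min F (\<lambda>x. x \<in> X) (arg_min_on F X)"
    unfolding arg_min_on_def arg_min_def by (rule someI)
  then show "arg_min_on F X \<in> X" "w \<in> X \<Longrightarrow> F (arg_min_on F X) \<le> F w"
    by (auto simp: is_arg_min_linorder)
qed

text \<open>The Pythagorean inequality is the case of \<open>minimizer_quadratic\<close> without
  linear part and with curvature 2.\<close>

lemma proj_compact_convex:
  assumes "compact X" "convex X" "w \<in> X"
  shows "proj X v \<in> X"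
    and "(norm (proj X v - v))\<^sup>2 + (norm (w - proj X v))\<^sup>2 \<le> (norm (w - v))\<^sup>2"
proof -
  have cont: "continuous_on X (\<lambda>p. norm (p - v))"
    by (intro continuous_intros)
  note am = arg_min_on_compact[OF assms(1) _ cont, folded proj_def]
  show mem: "proj X v \<in> X"
    using am assms(3) by auto
  show "(norm (proj X v - v))\<^sup>2 + (norm (w - proj X v))\<^sup>2 \<le> (norm (w - v))\<^sup>2"
    using minimizer_quadratic[of X "proj X v" w 0 2 v] assms mem am(2)
    by (auto intro: power_mono)
qed

section \<open>Smooth functions and projected gradient descent\<close>

text \<open>The query count does not depend on the answers of the oracle, so each subproblem costs
  the same.\<close>

lemma pgd_terminates: "\<exists>y'. pgd X L n x y orc = Some (y', n)"
proof (induction n arbitrary: y)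
  case 0
  then show ?case
    by (simp add: ret_def)
next
  case (Suc n)
  show ?case
    using Suc[of "proj X (y - (1 / (3 * L)) *\<^sub>R (snd (orc y) + (1 / lam L) *\<^sub>R (y - x)))"]
    by (auto simp: bind_comp_def query_def case_prod_beta)
qed

section \<open>Smoothness along segments\<close>

locale smooth_domain =
  fixes d :: nat and X :: "rvec set" and L :: real and f :: "rvec \<Rightarrow> real"
  assumes dom: "X \<subseteq> euclid d" "compact X" "convex X"
    and L_pos: "0 < L"
    and smooth: "smooth_in d L f X"
begin

abbreviation g :: "rvec \<Rightarrow> rvec" where
  "g \<equiv> grad d f"

abbreviation F :: "rvec \<Rightarrow> rvec \<Rightarrow> real" where
  "F \<equiv> prox_objective L f"

lemma F_eq: "F x y = f y + L * (norm (y - x))\<^sup>2"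
  using L_pos by (simp add: prox_objective_def lam_def)

lemma has_derivative_f:
  assumes "x \<in> X"
  shows "(f has_derivative (\<lambda>h. g x \<bullet> h)) (at x within euclid d)"
proof (rule grad_works)
  obtain U where U: "open U" "X \<subseteq> U" "f differentiable_on (U \<inter> euclid d)"
    using smooth by (auto simp: smooth_in_def differentiable_near_def)
  then have "f differentiable (at x within (euclid d \<inter> U))"
    using assms dom(1) by (auto simp: differentiable_on_def Int_commute)
  \<comment> \<open>As \<open>U\<close> is open, intersecting with it does not change the filter at
    \<open>x\<close>.\<close>
  then show "f differentiable (at x within euclid d)"
    using U assms at_within_nhd[of x U "euclid d \<inter> U" "euclid d"] by auto
  show "x \<in> euclid d"
    using assms dom(1) by auto
qed

lemma continuous_on_f: "continuous_on X f"
proof (rule has_derivative_continuous_on)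
  fix x assume "x \<in> X"
  then show "(f has_derivative (\<lambda>h. g x \<bullet> h)) (at x within X)"
    using has_derivative_f has_derivative_subset dom(1) by blast
qed

lemma continuous_on_F: "continuous_on X (F x)"
  unfolding F_eq by (intro continuous_intros continuous_on_f)

lemma segment_mem:
  assumes "x \<in> X" "y \<in> X" "0 \<le> t" "t \<le> 1"
  shows "x + t *\<^sub>R (y - x) \<in> X"
proof -
  have "(1 - t) *\<^sub>R x + t *\<^sub>R y \<in> X"
    using assms dom(3) by (intro convexD) auto
  then show ?thesis
    by (simp add: algebra_simps)
qed

lemma has_derivative_segment:
  assumes "x \<in> X" "y \<in> X" "0 \<le> t" "t \<le> 1"
  shows "((\<lambda>s. f (x + s *\<^sub>R (y - x))) has_real_derivative
    (g (x + t *\<^sub>R (y - x)) \<bullet> (y - x))) (at t within {0..1})"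
  using assms segment_mem dom(1)
  by (intro has_derivative_along_line[where S = "euclid d"] has_derivative_f) auto

lemma gradient_Lipschitz: "x \<in> X \<Longrightarrow> y \<in> X \<Longrightarrow> norm (g x - g y) \<le> L * norm (x - y)"
  using smooth by (auto simp: smooth_in_def)

text \<open>The Lipschitz bound is available only on \<open>X\<close>, so the estimate is obtained
  along the segment, which convexity keeps inside \<open>X\<close>.\<close>

lemma smooth_upper_lower:
  assumes x: "x \<in> X" and y: "y \<in> X"
  shows "\<bar>f y - f x - g x \<bullet> (y - x)\<bar> \<le> L / 2 * (norm (y - x))\<^sup>2"
proof -
  define v where "v = y - x"
  \<comment> \<open>The sign \<open>s\<close> handles both halves of the absolute value:
    \<open>r 1\<close> and \<open>r (- 1)\<close> are nonincreasing on [0, 1].\<close>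
  define r where "r s t = s * (f (x + t *\<^sub>R v) - t * (g x \<bullet> v)) - L / 2 * t\<^sup>2 * (norm v)\<^sup>2" for s t
  have "r s 1 \<le> r s 0" if s: "\<bar>s\<bar> = 1" for s
  proof (rule DERIV_nonpos_imp_decreasing_open[where f = "r s" and a = 0 and b = 1])
    fix t :: real assume t: "0 < t" "t < 1"
    define D where "D = s * (g (x + t *\<^sub>R v) \<bullet> v - g x \<bullet> v) - L * t * (norm v)\<^sup>2"
    have "((\<lambda>t. f (x + t *\<^sub>R v)) has_real_derivative (g (x + t *\<^sub>R v) \<bullet> v)) (at t)"
      using has_derivative_segment[OF x y, of t] t at_within_Icc_at[of 0 t 1] by (simp add: v_def)
    then have "(r s has_real_derivative D) (at t)"
      unfolding r_def D_def by (auto intro!: derivative_eq_intros)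
    moreover have "D \<le> 0"
    proof -
      have "s * (g (x + t *\<^sub>R v) \<bullet> v - g x \<bullet> v) \<le> \<bar>(g (x + t *\<^sub>R v) - g x) \<bullet> v\<bar>"
        using s by (auto simp: inner_diff_left abs_if split: if_splits)
      also have "\<dots> \<le> norm (g (x + t *\<^sub>R v) - g x) * norm v"
        by (rule Cauchy_Schwarz_ineq2)
      also have "\<dots> \<le> L * norm (x + t *\<^sub>R v - x) * norm v"
        using t by (intro mult_right_mono gradient_Lipschitz)
          (auto simp: v_def intro: segment_mem x y)
      also have "\<dots> = L * t * (norm v)\<^sup>2"
        using t by (simp add: power2_eq_square)
      finally show ?thesis
        by (simp add: D_def)
    qed
    ultimately show "\<exists>D. (r s has_real_derivative D) (at t) \<and> D \<le> 0"
      by blast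
  next
    have "continuous_on {0..1} (\<lambda>t. f (x + t *\<^sub>R v))"
      unfolding v_def
      by (rule DERIV_continuous_on, rule has_derivative_segment) (use x y in auto)
    then show "continuous_on {0..1} (r s)"
      unfolding r_def by (intro continuous_intros)
  qed simp
  from this[of 1] this[of "-1"] show ?thesis
    unfolding abs_le_iff by (simp add: r_def v_def)
qed

section \<open>Curvature of the subproblem objective\<close>

lemma F_eq_shift:
  "F x w = F x y - f y + f w + (2 * L) *\<^sub>R (y - x) \<bullet> (w - y) + L * (norm (w - y))\<^sup>2"
  by (simp add: F_eq power2_norm_eq_inner inner_simps inner_commute algebra_simps)

text \<open>The proximal term has curvature exactly 2L, while that of \<open>f\<close> lies between
  -L and L. So the subproblem has curvature between L and 3L although \<open>f\<close> need not be
  convex, which explains the step size 1/(3L).\<close>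

lemma F_upper:
  assumes "y \<in> X" "w \<in> X"
  shows "F x w \<le> F x y + (g y + (2 * L) *\<^sub>R (y - x)) \<bullet> (w - y) + 3 * L / 2 * (norm (w - y))\<^sup>2"
  using smooth_upper_lower[OF assms] F_eq_shift[of x w y] unfolding inner_add_left
  by linarith

lemma F_lower:
  assumes "y \<in> X" "w \<in> X"
  shows "F x w \<ge> F x y + (g y + (2 * L) *\<^sub>R (y - x)) \<bullet> (w - y) + L / 2 * (norm (w - y))\<^sup>2"
  using smooth_upper_lower[OF assms] F_eq_shift[of x w y] unfolding inner_add_left
  by linarith

section \<open>Exact proximal points\<close>

definition prox :: "rvec \<Rightarrow> rvec" where
  "prox x = arg_min_on (F x) X"

lemma prox:
  assumes "X \<noteq> {}"
  shows "prox x \<in> X" and "w \<in> X \<Longrightarrow> F x (prox x) \<le> F x w"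
    and "(INF w\<in>X. F x w) = F x (prox x)"
proof -
  note am = arg_min_on_compact[OF dom(2) assms continuous_on_F, folded prox_def]
  show "prox x \<in> X" "w \<in> X \<Longrightarrow> F x (prox x) \<le> F x w"
    using am by auto
  then show "(INF w\<in>X. F x w) = F x (prox x)"
    using am(2) by (intro cInf_eq_minimum) auto
qed

text \<open>With a negative slope towards \<open>w\<close>, a short step in that direction would
  decrease the objective, since the quadratic term of \<open>F_upper\<close> is of second order in
  the step.\<close>

lemma prox_optimality:
  assumes w: "w \<in> X"
  shows "(g (prox x) + (2 * L) *\<^sub>R (prox x - x)) \<bullet> (w - prox x) \<ge> 0"
proof (rule ccontr)
  define p where "p = prox x"
  define c where "c = (g p + (2 * L) *\<^sub>R (p - x)) \<bullet> (w - p)"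
  define q where "q = 3 * L / 2 * (norm (w - p))\<^sup>2"
  have p: "p \<in> X" "\<And>w. w \<in> X \<Longrightarrow> F x p \<le> F x w"
    unfolding p_def using w by (auto intro!: prox)
  have ineq: "0 \<le> t * c + t\<^sup>2 * q" if "0 \<le> t" "t \<le> 1" for t
  proof -
    have mem: "p + t *\<^sub>R (w - p) \<in> X"
      using segment_mem p w that by auto
    have "F x p \<le> F x (p + t *\<^sub>R (w - p))"
      using p(2) mem by blast
    also have "\<dots> \<le> F x p + t * c + t\<^sup>2 * q"
      using F_upper[OF p(1) mem, of x] by (simp add: c_def q_def power_mult_distrib mult_ac)
    finally show ?thesis
      by simp
  qed
  have q: "q \<ge> 0"
    using L_pos by (simp add: q_def)
  assume "\<not> 0 \<le> (g (prox x) + (2 * L) *\<^sub>R (prox x - x)) \<bullet> (w - prox x)"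
  then have c: "c < 0"
    by (simp add: c_def p_def)
  \<comment> \<open>Small enough for \<open>t * q < - c\<close>; the summand 1 makes this
    strict.\<close>
  define t where "t = - c / (- c + q + 1)"
  have t: "0 < t" "t \<le> 1"
    using c q by (auto simp: t_def divide_simps)
  have "t * q < - c"
    using c q by (simp add: t_def divide_simps)
  then have "t * (c + t * q) < 0"
    using t by (simp add: mult_less_0_iff)
  with ineq[of t] t show False
    by (simp add: power2_eq_square algebra_simps)
qed

lemma prox_strong_min:
  assumes "w \<in> X"
  shows "F x (prox x) + L / 2 * (norm (w - prox x))\<^sup>2 \<le> F x w"
proof -
  have "prox x \<in> X"
    using prox(1) assms by auto
  from F_lower[OF this assms, of x] prox_optimality[OF assms, of x] show ?thesis
    by linarith
qed

text \<open>The step minimizes over \<open>X\<close> the model of curvature 3L at \<open>y\<close>.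
  The Pythagorean inequality for this model is combined with \<open>F_upper\<close> at
  \<open>y'\<close> and \<open>F_lower\<close> at \<open>w\<close>; the curvature gap between 3L and
  L leaves the term in \<open>w - y\<close>.\<close>

lemma pgd_step:
  fixes x y
  defines "y' \<equiv> proj X (y - (1 / (3 * L)) *\<^sub>R (g y + (1 / lam L) *\<^sub>R (y - x)))"
  assumes y: "y \<in> X" and w: "w \<in> X"
  shows "y' \<in> X" "F x y' + 3 * L / 2 * (norm (w - y'))\<^sup>2 \<le> F x w + L * (norm (w - y))\<^sup>2"
proof -
  define G where "G = g y + (2 * L) *\<^sub>R (y - x)"
  have y': "y' = proj X (y - (1 / (3 * L)) *\<^sub>R G)"
    using L_pos by (simp add: y'_def G_def lam_def)
  show mem: "y' \<in> X"
    unfolding y' using proj_compact_convex(1)[OF dom(2,3) y] .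
  \<comment> \<open>Completing the square: the distance to the gradient step is, up to a constant,
    the model of curvature 3L.\<close>
  have expand: "3 * L / 2 * (norm (u - (y - (1 / (3 * L)) *\<^sub>R G)))\<^sup>2 =
      3 * L / 2 * (norm (u - y))\<^sup>2 + G \<bullet> (u - y) + 1 / (6 * L) * (norm G)\<^sup>2" for u
  proof -
    have "3 * L / 2 * (norm (e + (1 / (3 * L)) *\<^sub>R G))\<^sup>2 =
        3 * L / 2 * (norm e)\<^sup>2 + G \<bullet> e + 1 / (6 * L) * (norm G)\<^sup>2" for e
      using L_pos by (simp add: power2_norm_eq_inner inner_add_left inner_add_right inner_commute
          field_simps)
    from this[of "u - y"] show ?thesis
      by (simp add: algebra_simps)
  qed
  have "3 * L / 2 * ((norm (y' - (y - (1 / (3 * L)) *\<^sub>R G)))\<^sup>2 + (norm (w - y'))\<^sup>2)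
      \<le> 3 * L / 2 * (norm (w - (y - (1 / (3 * L)) *\<^sub>R G)))\<^sup>2"
    unfolding y' using L_pos by (intro mult_left_mono proj_compact_convex dom w) auto
  then have "3 * L / 2 * (norm (y' - y))\<^sup>2 + G \<bullet> (y' - y) + 3 * L / 2 * (norm (w - y'))\<^sup>2
      \<le> 3 * L / 2 * (norm (w - y))\<^sup>2 + G \<bullet> (w - y)"
    unfolding distrib_left expand by simp
  with F_upper[OF y mem, of x, folded G_def] F_lower[OF y w, of x, folded G_def]
  show "F x y' + 3 * L / 2 * (norm (w - y'))\<^sup>2 \<le> F x w + L * (norm (w - y))\<^sup>2"
    by (simp add: algebra_simps)
qed

text \<open>The first \<open>n\<close> steps each contract the squared distance to
  \<open>prox x\<close> by 2/3; the last one turns distance into function value, hence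
  \<open>Suc n\<close> steps for the exponent \<open>n\<close>.\<close>

lemma pgd_convergence:
  assumes "y \<in> X"
  shows "\<exists>y'. pgd X L (Suc n) x y (first_order_oracle d f) = Some (y', Suc n) \<and> y' \<in> X \<and>
    F x y' \<le> F x (prox x) + L * (2 / 3) ^ n * (norm (prox x - y))\<^sup>2"
  using assms
proof (induction n arbitrary: y)
  case 0
  have p: "prox x \<in> X"
    using prox(1) 0 by auto
  define y' where "y' = proj X (y - (1 / (3 * L)) *\<^sub>R (g y + (1 / lam L) *\<^sub>R (y - x)))"
  have "0 \<le> 3 * L / 2 * (norm (prox x - y'))\<^sup>2"
    using L_pos by simp
  with pgd_step[OF 0 p, of x] show ?case
    by (auto simp: bind_comp_def query_def ret_def first_order_oracle_def simp flip: y'_def)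
next
  case (Suc n)
  have p: "prox x \<in> X"
    using prox(1) Suc.prems by auto
  define y' where "y' = proj X (y - (1 / (3 * L)) *\<^sub>R (g y + (1 / lam L) *\<^sub>R (y - x)))"
  note step = pgd_step[OF Suc.prems p, of x, folded y'_def]
  obtain y'' where y'': "pgd X L (Suc n) x y' (first_order_oracle d f) = Some (y'', Suc n)" "y'' \<in> X"
      "F x y'' \<le> F x (prox x) + L * (2 / 3) ^ n * (norm (prox x - y'))\<^sup>2"
    using Suc.IH[OF step(1)] by blast
  \<comment> \<open>Minimality of \<open>prox x\<close> lets the function values be dropped from
    \<open>pgd_step\<close>.\<close>
  have "3 * L / 2 * (norm (prox x - y'))\<^sup>2 \<le> L * (norm (prox x - y))\<^sup>2"
    using step(2) prox(2)[OF _ step(1), of x] p by fastforce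
  then have "(norm (prox x - y'))\<^sup>2 \<le> 2 / 3 * (norm (prox x - y))\<^sup>2"
    using L_pos by (simp add: field_simps)
  then have "L * (2 / 3) ^ n * (norm (prox x - y'))\<^sup>2 \<le> L * (2 / 3) ^ n * (2 / 3 * (norm (prox x - y))\<^sup>2)"
    using L_pos by (intro mult_left_mono) auto
  with y''(3) have "F x y'' \<le> F x (prox x) + L * (2 / 3) ^ Suc n * (norm (prox x - y))\<^sup>2"
    by simp
  moreover have "pgd X L (Suc (Suc n)) x y (first_order_oracle d f) = Some (y'', Suc (Suc n))"
    using y''(1) unfolding pgd.simps(2)[of X L "Suc n"]
    by (simp add: bind_comp_def query_def first_order_oracle_def y'_def del: pgd.simps)
  ultimately show ?case
    using y''(2) by blast
qed

end

section \<open>Inexact Moreau envelope\<close>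

locale prox_solver = smooth_domain +
  fixes \<delta> :: real and N :: nat and s :: "rvec \<Rightarrow> rvec"
  assumes \<delta>_pos: "0 < \<delta>"
    and solves: "\<And>x. x \<in> X \<Longrightarrow> \<exists>y n. pgd X L N x (s x) (first_order_oracle d f) = Some (y, n) \<and>
      approx_minimizer \<delta> (F x) X y"
begin

abbreviation orc :: oracle_fun where
  "orc \<equiv> first_order_oracle d f"

text \<open>The use of \<open>the\<close> is harmless because \<open>pgd_terminates\<close> excludes
  \<open>None\<close>.\<close>

definition pt :: "rvec \<Rightarrow> rvec" where
  "pt x = fst (the (pgd X L N x (s x) orc))"

definition h :: "rvec \<Rightarrow> real" where
  "h x = F x (pt x)"

definition G :: "rvec \<Rightarrow> rvec" where
  "G x = (2 * L) *\<^sub>R (x - pt x)"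

lemma prox_point_eq: "prox_point X L N s x orc = Some (pt x, N)"
  using pgd_terminates[of X L N x "s x" orc] by (auto simp: prox_point_def pt_def)

lemma pt:
  assumes x: "x \<in> X"
  shows "pt x \<in> X" and "w \<in> X \<Longrightarrow> h x \<le> F x w + \<delta>"
proof -
  have ne: "X \<noteq> {}"
    using x by auto
  from solves[OF x] have "approx_minimizer \<delta> (F x) X (pt x)"
    by (auto simp: pt_def)
  then have *: "pt x \<in> X" "h x \<le> F x (prox x) + \<delta>"
    by (auto simp: approx_minimizer_def h_def prox(3)[OF ne])
  show "pt x \<in> X"
    by (rule *)
  show "h x \<le> F x w + \<delta>" if "w \<in> X"
    using *(2) prox(2)[OF ne that, of x] by linarith
qed

lemma approx_moreau_eq: "approx_moreau X L N s x orc = Some ((h x, G x), N + 1)"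
proof -
  have "h x = f (pt x) + 1 / (2 * lam L) * (norm (pt x - x))\<^sup>2" "G x = (1 / lam L) *\<^sub>R (x - pt x)"
    using L_pos by (simp_all add: h_def prox_objective_def G_def lam_def)
  then show ?thesis
    using prox_point_eq[of x]
    by (simp add: approx_moreau_def bind_comp_def query_def ret_def first_order_oracle_def)
qed

text \<open>
  Testing the subproblem at \<open>x'\<close> with the inexact solution for \<open>x\<close> makes this upper model exact up
  to \<open>\<delta>\<close>, although \<open>G\<close> may be off by \<open>sqrt (8 L \<delta>)\<close>.
\<close>

lemma h_model:
  assumes "x \<in> X" "x' \<in> X"
  shows "h x' \<le> h x + \<delta> + G x \<bullet> (x' - x) + L * (norm (x' - x))\<^sup>2"
proof -
  have "h x' \<le> F x' (pt x) + \<delta>"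
    using pt assms by blast
  also have "F x' (pt x) = h x + G x \<bullet> (x' - x) + L * (norm (x' - x))\<^sup>2"
    unfolding h_def F_eq G_def power2_norm_eq_inner
    by (simp add: inner_simps inner_commute algebra_simps)
  finally show ?thesis
    by simp
qed

lemma h_le_f: "x \<in> X \<Longrightarrow> h x \<le> f x + \<delta>"
  using pt(2)[of x x] by (simp add: F_eq)

text \<open>Quadratic growth around the exact minimizer turns the value error \<delta> into a
  distance of at most sqrt (2 \<delta> / L). Multiplied by 2L, this is the gradient error sqrt (8 L
  \<delta>).\<close>

lemma pt_near_prox:
  assumes x: "x \<in> X"
  shows "2 * L * norm (pt x - prox x) \<le> sqrt (8 * L * \<delta>)"
proof (rule real_le_rsqrt)
  have ne: "X \<noteq> {}"
    using x by auto
  have "F x (prox x) + L / 2 * (norm (pt x - prox x))\<^sup>2 \<le> F x (prox x) + \<delta>"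
    using prox_strong_min[OF pt(1)[OF x], of x] pt(2)[OF x prox(1)[OF ne], of x] by (simp add: h_def)
  then have "(8 * L) * (L / 2 * (norm (pt x - prox x))\<^sup>2) \<le> (8 * L) * \<delta>"
    using L_pos by (intro mult_left_mono) auto
  then show "(2 * L * norm (pt x - prox x))\<^sup>2 \<le> 8 * L * \<delta>"
    by (simp add: power_mult_distrib power2_eq_square[of L])
qed

text \<open>Quasar convexity is applied at the exact point \<open>p\<close>, because the variational
  inequality is available there; only afterwards is \<open>p\<close> exchanged for
  \<open>pt x\<close> in the linear term.\<close>

lemma quasar_bound:
  assumes quasar: "quasar_convex_in d \<gamma> f X xs" and x: "x \<in> X"
    and D: "norm (xs - x) \<le> D"
  shows "f xs \<ge> f (pt x) + L * (norm (x - pt x))\<^sup>2 - \<delta> + 1 / \<gamma> * (G x \<bullet> (xs - x))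
    - 1 / \<gamma> * (sqrt (8 * L * \<delta>) * D)"
proof -
  define p where "p = prox x"
  have \<gamma>: "0 < \<gamma>" "\<gamma> \<le> 1" and xs: "xs \<in> X"
    using quasar by (auto simp: quasar_convex_in_def is_arg_min_linorder)
  have p: "p \<in> X"
    using prox(1) x by (auto simp: p_def)
  have "f xs \<ge> f p + 1 / \<gamma> * (g p \<bullet> (xs - p))"
    using quasar p by (auto simp: quasar_convex_in_def)
  moreover have "f p + L * (norm (p - x))\<^sup>2 \<ge> f (pt x) + L * (norm (x - pt x))\<^sup>2 - \<delta>"
    using pt(2)[OF x p] by (simp add: h_def F_eq norm_minus_commute)
  moreover have "1 / \<gamma> * (g p \<bullet> (xs - p)) \<ge> 1 / \<gamma> * (G x \<bullet> (xs - x))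
    - 1 / \<gamma> * (sqrt (8 * L * \<delta>) * D) + L * (norm (p - x))\<^sup>2"
  proof -
    have "g p \<bullet> (xs - p) \<ge> 2 * L * ((x - p) \<bullet> (xs - p))"
      using prox_optimality[OF xs, of x, folded p_def] by (simp add: inner_simps algebra_simps)
    also have "2 * L * ((x - p) \<bullet> (xs - p)) =
        G x \<bullet> (xs - x) + (2 * L) *\<^sub>R (pt x - p) \<bullet> (xs - x) + 2 * L * (norm (p - x))\<^sup>2"
      unfolding G_def power2_norm_eq_inner by (simp add: inner_simps inner_commute algebra_simps)
    finally have 1: "g p \<bullet> (xs - p) \<ge>
        G x \<bullet> (xs - x) + (2 * L) *\<^sub>R (pt x - p) \<bullet> (xs - x) + 2 * L * (norm (p - x))\<^sup>2" .
    have "\<bar>(2 * L) *\<^sub>R (pt x - p) \<bullet> (xs - x)\<bar> \<le> norm ((2 * L) *\<^sub>R (pt x - p)) * norm (xs - x)"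
      by (rule Cauchy_Schwarz_ineq2)
    also have "\<dots> \<le> sqrt (8 * L * \<delta>) * D"
      using pt_near_prox[OF x] L_pos D \<delta>_pos by (intro mult_mono) (auto simp: p_def)
    finally have "g p \<bullet> (xs - p) \<ge>
        G x \<bullet> (xs - x) - sqrt (8 * L * \<delta>) * D + 2 * L * (norm (p - x))\<^sup>2"
      using 1 by linarith
    then have "1 / \<gamma> * (g p \<bullet> (xs - p)) \<ge>
        1 / \<gamma> * (G x \<bullet> (xs - x) - sqrt (8 * L * \<delta>) * D + 2 * L * (norm (p - x))\<^sup>2)"
      using \<gamma> by (intro mult_left_mono) auto
    \<comment> \<open>As \<gamma> \<le> 1, this square pays for turning \<open>f p\<close> into the
      subproblem value at \<open>p\<close>, which is compared with \<open>h x\<close>.\<close>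
    moreover have "1 / \<gamma> * (2 * L * (norm (p - x))\<^sup>2) \<ge> 1 * (L * (norm (p - x))\<^sup>2)"
      using \<gamma> L_pos by (intro mult_mono) auto
    ultimately show ?thesis
      by (simp add: algebra_simps)
  qed
  ultimately show ?thesis
    by linarith
qed

end

section \<open>Binary line search\<close>

text \<open>The line search reduced to one real variable. Neither continuity nor convexity of
  \<open>hh\<close> is assumed, and \<open>gh\<close> need not be its derivative.\<close>

locale bisection =
  fixes hh gh :: "real \<Rightarrow> real" and \<delta> \<sigma> :: real
  assumes \<delta>_pos: "0 < \<delta>" and \<sigma>_nonneg: "0 \<le> \<sigma>"
    and model: "\<And>\<alpha> \<beta>. \<alpha> \<in> {0..1} \<Longrightarrow> \<beta> \<in> {0..1} \<Longrightarrow>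
      hh \<beta> \<le> hh \<alpha> + \<delta> + gh \<alpha> * (\<beta> - \<alpha>) + (\<sigma> * (\<beta> - \<alpha>))\<^sup>2 / (2 * \<delta>)"
begin

text \<open>The last conjunct is what bounds the number of halvings: intervals of width at most 3
  \<delta> / \<sigma> are never brackets when \<sigma> > 0.\<close>

definition bracket :: "real \<Rightarrow> real \<Rightarrow> bool" where
  "bracket a b \<longleftrightarrow> 0 \<le> a \<and> a < b \<and> b \<le> 1 \<and> hh a \<ge> hh 1 - \<delta> \<and> gh b > 2 * \<sigma> \<and>
    (b = 1 \<or> hh b < hh 1 - \<delta>) \<and> 3 * \<delta> < \<sigma> * (b - a)"

text \<open>Moving left from \<open>b\<close>, the slope lowers the model by more than 2 \<delta>
  \<tau>, while the quadratic term adds only \<delta> \<tau>^2 / 2.\<close>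

lemma model_left:
  assumes "0 \<le> a" "a < b" "b \<le> 1" "gh b > 2 * \<sigma>" "\<sigma> * (b - a) = \<delta> * \<tau>"
  shows "hh a < hh b + \<delta> * (1 - 2 * \<tau> + \<tau>\<^sup>2 / 2)"
proof -
  have "hh a \<le> hh b + \<delta> + gh b * (a - b) + (\<sigma> * (a - b))\<^sup>2 / (2 * \<delta>)"
    using model[of b a] assms by simp
  moreover have "\<sigma> * (a - b) = - (\<delta> * \<tau>)"
    using assms(5) by (simp add: algebra_simps)
  then have "(\<sigma> * (a - b))\<^sup>2 / (2 * \<delta>) = \<delta> * (\<tau>\<^sup>2 / 2)"
    using \<delta>_pos by (simp add: power2_eq_square)
  moreover have "gh b * (b - a) > 2 * \<sigma> * (b - a)"
    using assms by (intro mult_strict_right_mono) auto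
  then have "gh b * (a - b) < - 2 * (\<delta> * \<tau>)"
    using assms(5) by (simp add: algebra_simps)
  ultimately show ?thesis
    by (simp add: algebra_simps)
qed

text \<open>The assumed drop exceeds \<delta> and so cancels the additive \<delta> of the model.
  This leaves \<tau> (\<tau> - 4) > 0, hence a width above 4 > 3.\<close>

lemma initial_bracket:
  assumes "hh 0 > hh 1 + \<delta>" "gh 1 > 2 * \<sigma>"
  shows "bracket 0 1"
proof -
  define \<tau> where "\<tau> = \<sigma> / \<delta>"
  have \<tau>: "\<sigma> * (1 - 0) = \<delta> * \<tau>"
    using \<delta>_pos by (simp add: \<tau>_def)
  from model_left[OF _ _ _ assms(2) \<tau>] assms(1)
  have "\<delta> * 0 < \<delta> * (\<tau>\<^sup>2 / 2 - 2 * \<tau>)"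
    by (simp add: algebra_simps)
  then have "0 < \<tau>\<^sup>2 / 2 - 2 * \<tau>"
    unfolding mult_less_cancel_left_pos[OF \<delta>_pos] .
  then have "0 < \<tau> * (\<tau> - 4)"
    by (simp add: power2_eq_square algebra_simps)
  moreover have "0 \<le> \<tau>"
    using \<delta>_pos \<sigma>_nonneg by (simp add: \<tau>_def)
  ultimately have "4 < \<tau>"
    by (auto simp: zero_less_mult_iff)
  then show ?thesis
    using assms \<delta>_pos by (auto simp: bracket_def \<tau>_def field_simps)
qed

text \<open>
  Let \<open>\<tau>\<close> be the width of a bracket in units of \<open>\<delta> / \<sigma>\<close>. The model excludes all values of \<open>\<tau>\<close> in
  \<open>(3/2, 3]\<close>, so the width can never be halved from above 3 to below 3. For \<open>b < 1\<close> one application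
  of the model suffices: \<open>1 - 2 \<tau> + \<tau>\<^sup>2 / 2 < 0\<close> on this range contradicts \<open>hh a \<ge> hh 1 - \<delta> > hh b\<close>. For
  \<open>b = 1\<close> the latter gap is missing, and the model is applied twice, from 1 to the midpoint and from
  the midpoint to \<open>a\<close>, which leads to \<open>3 - 4 \<tau> + \<tau>\<^sup>2\<close>.
\<close>

lemma bisection_step:
  assumes br: "bracket a b" and c: "0 \<le> c" and \<alpha>: "\<alpha> = (a + b) / 2" and tol: "2 * \<sigma> \<le> \<tau>0"
    and fail: "\<alpha> * gh \<alpha> > c * (hh 1 - hh \<alpha>) + \<tau>0"
  shows "if hh \<alpha> \<ge> hh 1 - \<delta> then bracket \<alpha> b else bracket a \<alpha>"
proof -
  define \<tau> where "\<tau> = \<sigma> * (b - a) / (2 * \<delta>)"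
  have ab: "0 \<le> a" "a < \<alpha>" "\<alpha> < b" "b \<le> 1" "hh a \<ge> hh 1 - \<delta>" "gh b > 2 * \<sigma>"
    using br \<alpha> by (auto simp: bracket_def)
  have \<tau>: "\<sigma> * (\<alpha> - a) = \<delta> * \<tau>" "\<sigma> * (b - \<alpha>) = \<delta> * \<tau>"
    using \<delta>_pos by (simp_all add: \<alpha> \<tau>_def field_simps)
  \<comment> \<open>Here \<tau> measures half of the bracket, hence half of the bound 3.\<close>
  have \<tau>_gt: "3 / 2 < \<tau>"
    using br \<delta>_pos by (simp add: bracket_def \<tau>_def field_simps)
  have wide1: "3 < \<tau>" if "0 < \<delta> * (1 - 2 * \<tau> + \<tau>\<^sup>2 / 2)"
  proof (rule ccontr)
    assume "\<not> 3 < \<tau>"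
    then have "(\<tau> - 3 / 2) * (\<tau> - 3) \<le> 0"
      using \<tau>_gt by (simp add: mult_le_0_iff)
    moreover have "0 < 1 - 2 * \<tau> + \<tau>\<^sup>2 / 2"
      using that \<delta>_pos by (simp add: zero_less_mult_iff)
    ultimately show False
      using \<open>\<not> 3 < \<tau>\<close>
      unfolding power2_eq_square left_diff_distrib right_diff_distrib by linarith
  qed
  have wide2: "3 < \<tau>" if "0 < \<delta> * (3 - 4 * \<tau> + \<tau>\<^sup>2)"
  proof (rule ccontr)
    assume "\<not> 3 < \<tau>"
    then have "(\<tau> - 1) * (\<tau> - 3) \<le> 0"
      using \<tau>_gt by (simp add: mult_le_0_iff)
    moreover have "0 < 3 - 4 * \<tau> + \<tau>\<^sup>2"
      using that \<delta>_pos by (simp add: zero_less_mult_iff)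
    ultimately show False
      by (simp add: power2_eq_square algebra_simps)
  qed
  \<comment> \<open>The term with \<open>c\<close> is nonnegative here, and \<alpha> \<le> 1 allows
    the factor \<alpha> to be removed from the failed test.\<close>
  have slope: "gh \<alpha> > 2 * \<sigma>" if "hh \<alpha> \<le> hh 1"
  proof -
    have "0 \<le> c * (hh 1 - hh \<alpha>)"
      using that c by simp
    then have *: "\<alpha> * gh \<alpha> > 2 * \<sigma>"
      using fail tol by linarith
    then have "0 < gh \<alpha>"
      using \<sigma>_nonneg ab by (smt (verit) zero_less_mult_iff)
    then have "\<alpha> * gh \<alpha> \<le> 1 * gh \<alpha>"
      using ab by (intro mult_right_mono) auto
    with * show ?thesis
      by simp
  qed
  have "3 < \<tau>"
  proof (cases "hh \<alpha> \<ge> hh 1 - \<delta>")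
    case False
    then have "gh \<alpha> > 2 * \<sigma>"
      using \<delta>_pos by (intro slope) auto
    from model_left[OF _ _ _ this \<tau>(1)] ab False show ?thesis
      by (intro wide1) auto
  next
    case True
    have *: "hh \<alpha> < hh b + \<delta> * (1 - 2 * \<tau> + \<tau>\<^sup>2 / 2)"
      using model_left[OF _ _ _ _ \<tau>(2)] ab by auto
    show ?thesis
    proof (cases "b = 1 \<and> hh \<alpha> \<le> hh 1")
      \<comment> \<open>Either \<open>b < 1\<close>, where the bracket gives
        \<open>hh b < hh 1 - \<delta>\<close>, or \<open>b = 1\<close> and
        \<open>hh 1 < hh \<alpha>\<close>. In both cases \<open>hh b < hh \<alpha>\<close>.\<close>
      case False
      then show ?thesis
        using * True br by (intro wide1) (auto simp: bracket_def)
    next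
      case b1: True
      have "hh a < hh \<alpha> + \<delta> * (1 - 2 * \<tau> + \<tau>\<^sup>2 / 2)"
        using model_left[OF _ _ _ _ \<tau>(1)] ab slope b1 by auto
      with * b1 ab(5) show ?thesis
        by (intro wide2) (simp add: algebra_simps)
    qed
  qed
  then have "3 * \<delta> < \<sigma> * (b - \<alpha>)" "3 * \<delta> < \<sigma> * (\<alpha> - a)"
    using \<delta>_pos by (simp_all add: \<tau>)
  then show ?thesis
    using ab slope \<delta>_pos br unfolding bracket_def by auto
qed

end

context prox_solver
begin

lemma segment_point_mem:
  assumes "y \<in> X" "z \<in> X" "\<alpha> \<in> {0..1}"
  shows "segment_point y z \<alpha> \<in> X"
  unfolding segment_point_def using assms dom(3) by (intro convexD) auto

text \<open>\<open>J\<close> bounds the halvings from width 1 down to a width that no bracket can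
  have. The factor \<open>2 + J\<close> counts the two endpoint evaluations and at most
  \<open>J\<close> trials, each costing \<open>N\<close> steps and one value query.\<close>

lemma binary_line_search_correct:
  assumes y: "y \<in> X" and z: "z \<in> X" and c: "0 \<le> c"
    and J: "sqrt (2 * L * \<delta>) * norm (y - z) \<le> 3 * \<delta> * 2 ^ J"
  shows "\<exists>x q. binary_line_search X L \<delta> N s y z c orc = Some (x, q) \<and> x \<in> X \<and>
    G x \<bullet> (x - z) \<le> c * (h y - h x) + line_search_tol L \<delta> y z c \<and> q \<le> (2 + J) * (N + 1)"
proof -
  define v where "v = segment_point y z"
  define hh where "hh \<alpha> = h (v \<alpha>)" for \<alpha>
  define gh where "gh \<alpha> = G (v \<alpha>) \<bullet> (y - z)" for \<alpha>
  \<comment> \<open>This scale turns the quadratic term of \<open>h_model\<close> into the form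
    required by \<open>bisection\<close>, and makes the first term of the tolerance equal to 2
    \<sigma>.\<close>
  define \<sigma> where "\<sigma> = sqrt (2 * L * \<delta>) * norm (y - z)"
  define \<epsilon>' where "\<epsilon>' = line_search_tol L \<delta> y z c"
  have v_mem: "v \<alpha> \<in> X" if "\<alpha> \<in> {0..1}" for \<alpha>
    using segment_point_mem y z that by (simp add: v_def)
  have v_diff: "v \<beta> - v \<alpha> = (\<beta> - \<alpha>) *\<^sub>R (y - z)" for \<alpha> \<beta>
    by (simp add: v_def segment_point_def algebra_simps)
  have v01: "v 1 = y" "v 0 = z"
    by (simp_all add: v_def segment_point_def)
  have moreau: "approx_moreau X L N s (v \<alpha>) orc = Some ((hh \<alpha>, G (v \<alpha>)), N + 1)" for \<alpha>
    by (simp add: approx_moreau_eq hh_def)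
  have "sqrt (8 * L * \<delta>) = sqrt (2\<^sup>2 * (2 * L * \<delta>))"
    by simp
  also have "\<dots> = 2 * sqrt (2 * L * \<delta>)"
    by (subst real_sqrt_mult) simp
  finally have \<epsilon>'_eq: "\<epsilon>' = 2 * \<sigma> + (9 + 5 * c) * \<delta>"
    by (simp add: \<epsilon>'_def line_search_tol_def \<sigma>_def)
  have \<epsilon>'_ge: "2 * \<sigma> \<le> \<epsilon>'" "c * \<delta> \<le> \<epsilon>'" "0 \<le> \<sigma>" "0 \<le> \<epsilon>'"
    using c \<delta>_pos L_pos by (simp_all add: \<epsilon>'_eq \<sigma>_def algebra_simps)
  interpret bisection hh gh \<delta> \<sigma>
  proof
    fix \<alpha> \<beta> :: real assume \<alpha>\<beta>: "\<alpha> \<in> {0..1}" "\<beta> \<in> {0..1}"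
    have "\<sigma>\<^sup>2 = 2 * L * \<delta> * (norm (y - z))\<^sup>2"
      using \<delta>_pos L_pos by (simp add: \<sigma>_def power_mult_distrib)
    then have "(\<sigma> * (\<beta> - \<alpha>))\<^sup>2 / (2 * \<delta>) = L * (norm ((\<beta> - \<alpha>) *\<^sub>R (y - z)))\<^sup>2"
      using \<delta>_pos by (simp add: power_mult_distrib)
    then show "hh \<beta> \<le> hh \<alpha> + \<delta> + gh \<alpha> * (\<beta> - \<alpha>) + (\<sigma> * (\<beta> - \<alpha>))\<^sup>2 / (2 * \<delta>)"
      using h_model[OF v_mem v_mem, OF \<alpha>\<beta>] by (simp add: hh_def gh_def v_diff mult.commute)
  qed (use \<delta>_pos \<epsilon>'_ge in auto)
  define good where "good x \<longleftrightarrow> x \<in> X \<and> G x \<bullet> (x - z) \<le> c * (h y - h x) + \<epsilon>'" for x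
  \<comment> \<open>Since \<open>v \<alpha> - z\<close> is \<alpha> times \<open>y - z\<close>,
    passing the stopping test is the required inequality.\<close>
  have good_v: "good (v \<alpha>)" if "\<alpha> \<in> {0..1}" "\<alpha> * gh \<alpha> \<le> c * (hh 1 - hh \<alpha>) + \<epsilon>'" for \<alpha>
    using that v_mem v_diff[of \<alpha> 0] by (simp add: good_def v01 hh_def gh_def)
  \<comment> \<open>Induction on the remaining halvings \<open>m\<close>; for \<open>m = 0\<close>
    the width is 2^(-J), which contradicts the bracket.\<close>
  have loop: "\<exists>x q. iterate (line_search_step X L \<delta> N s y z c (hh 1)) (a, b, (a + b) / 2) orc = Some (x, q)
      \<and> good x \<and> q \<le> m * (N + 1)"
    if "bracket a b" "b - a = (1 / 2) ^ k" "k + m = J" for a b k m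
    using that
  proof (induction m arbitrary: a b k)
    case 0
    then have "3 * \<delta> < \<sigma> / 2 ^ J"
      by (simp add: bracket_def power_divide)
    with J show ?case
      by (simp add: \<sigma>_def field_simps)
  next
    case (Suc m)
    define \<alpha> where "\<alpha> = (a + b) / 2"
    have \<alpha>: "\<alpha> \<in> {0..1}"
      using Suc.prems(1) by (auto simp: \<alpha>_def bracket_def)
    define r where "r = (if \<alpha> * gh \<alpha> > c * (hh 1 - hh \<alpha>) + \<epsilon>'
         then if hh \<alpha> \<ge> hh 1 - \<delta> then Inl (\<alpha>, b, (\<alpha> + b) / 2) else Inl (a, \<alpha>, (a + \<alpha>) / 2)
         else Inr (v \<alpha>))"
    have step: "line_search_step X L \<delta> N s y z c (hh 1) (a, b, \<alpha>) orc = Some (r, N + 1)"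
      using moreau[of \<alpha>]
      by (simp add: line_search_step_def bind_comp_def ret_def r_def gh_def \<epsilon>'_def v_def)
    show ?case
    proof (cases "\<alpha> * gh \<alpha> > c * (hh 1 - hh \<alpha>) + \<epsilon>'")
      case False
      then have "r = Inr (v \<alpha>)"
        by (simp add: r_def)
      with step have "iterate (line_search_step X L \<delta> N s y z c (hh 1)) (a, b, (a + b) / 2) orc
          = Some (v \<alpha>, N + 1)"
        by (subst iterate.simps) (simp add: \<alpha>_def)
      with good_v[OF \<alpha>] False show ?thesis
        by auto
    next
      case True
      have halves: "b - \<alpha> = (b - a) / 2" "\<alpha> - a = (b - a) / 2"
        by (simp_all add: \<alpha>_def field_simps)
      obtain a' b' where r: "r = Inl (a', b', (a' + b') / 2)" and "bracket a' b'"
        and "b' - a' = (b - a) / 2"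
      proof (cases "hh \<alpha> \<ge> hh 1 - \<delta>")
        case high: True
        then show thesis
          using that[of \<alpha> b] True halves(1)
            bisection_step[OF Suc.prems(1) c \<alpha>_def \<epsilon>'_ge(1) True] by (simp add: r_def)
      next
        case False
        then show thesis
          using that[of a \<alpha>] True halves(2)
            bisection_step[OF Suc.prems(1) c \<alpha>_def \<epsilon>'_ge(1) True] by (simp add: r_def)
      qed
      moreover have "b' - a' = (1 / 2) ^ Suc k"
        using \<open>b' - a' = (b - a) / 2\<close> Suc.prems(2) by simp
      ultimately obtain x q where
        "iterate (line_search_step X L \<delta> N s y z c (hh 1)) (a', b', (a' + b') / 2) orc = Some (x, q)"
        "good x" "q \<le> m * (N + 1)"
        using Suc.IH[of a' b' "Suc k"] Suc.prems(3) by auto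
      moreover from this step r
      have "iterate (line_search_step X L \<delta> N s y z c (hh 1)) (a, b, (a + b) / 2) orc
          = Some (x, N + 1 + q)"
        by (subst iterate.simps) (simp add: \<alpha>_def)
      ultimately show ?thesis
        by auto
    qed
  qed
  have search: "binary_line_search X L \<delta> N s y z c orc =
      (if gh 1 \<le> \<epsilon>' then Some (y, N + 1)
       else if hh 1 - hh 0 \<ge> - \<delta> then Some (z, 2 * (N + 1))
       else case iterate (line_search_step X L \<delta> N s y z c (hh 1)) (0, 1, 1 / 2) orc of
         None \<Rightarrow> None | Some (x, q) \<Rightarrow> Some (x, 2 * (N + 1) + q))"
    using moreau[of 0] moreau[of 1] v01
    by (auto simp: binary_line_search_def bind_comp_def ret_def gh_def \<epsilon>'_def v_def
        split: option.splits)
  consider "gh 1 \<le> \<epsilon>'" | "gh 1 > \<epsilon>'" "hh 1 - hh 0 \<ge> - \<delta>" | "gh 1 > \<epsilon>'" "hh 1 - hh 0 < - \<delta>"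
    by linarith
  then have "\<exists>x q. binary_line_search X L \<delta> N s y z c orc = Some (x, q) \<and> good x \<and> q \<le> (2 + J) * (N + 1)"
  proof cases
    case 1
    then show ?thesis
      using good_v[of 1] by (auto simp: search v01)
  next
    case 2
    \<comment> \<open>For \<alpha> = 0 the left side of the test vanishes, and the tolerance absorbs
      the possible loss \<open>c * \<delta>\<close>.\<close>
    have "c * - \<delta> \<le> c * (hh 1 - hh 0)"
      using 2(2) c by (intro mult_left_mono) auto
    then have "good z"
      using good_v[of 0] \<epsilon>'_ge(2) by (simp add: v01)
    with 2 show ?thesis
      by (auto simp: search)
  next
    case 3
    then have "bracket 0 1"
      using \<epsilon>'_ge(1) by (intro initial_bracket) auto
    from loop[OF this, of 0 J] 3 show ?thesis
      by (auto simp: search)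
  qed
  then show ?thesis
    by (simp add: good_def \<epsilon>'_def)
qed

end

section \<open>Potential of the accelerated method\<close>

lemma weight_sum_Suc: "weight_sum L \<gamma> (Suc k) = weight_sum L \<gamma> k + weight L \<gamma> (Suc k)"
  by (simp add: weight_sum_def)

lemma weight_sum_closed_form:
  "weight_sum L \<gamma> k = \<gamma>\<^sup>2 * (real k * (real k + 1)) / (16 * L)"
proof (induction k)
  case (Suc k)
  show ?case
    unfolding weight_sum_Suc Suc weight_def
    by (cases "L = 0") (auto simp: field_simps)
qed (simp add: weight_sum_def)

text \<open>The objective whose minimizer \<open>rounds\<close> stores as \<open>z\<close>, called
  psi_t in the overview. Keeping it unnormalized makes each round add a single linear term.\<close>

definition dual_avg :: "real \<Rightarrow> real \<Rightarrow> rvec \<Rightarrow> (nat \<Rightarrow> rvec) \<Rightarrow> nat \<Rightarrow> rvec \<Rightarrow> real" where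
  "dual_avg L \<gamma> x0 Gs k w =
    (\<Sum>i=1..k. weight L \<gamma> i / \<gamma> * (Gs i \<bullet> w)) + 1 / 2 * (norm (w - x0))\<^sup>2"

lemma dual_avg_Suc:
  "dual_avg L \<gamma> x0 (Gs(Suc k := v)) (Suc k) w =
    dual_avg L \<gamma> x0 Gs k w + weight L \<gamma> (Suc k) / \<gamma> * (v \<bullet> w)"
  by (simp add: dual_avg_def)

lemma dual_avg_strong_min:
  assumes "convex X" "z \<in> X" "w \<in> X"
    and "\<And>w. w \<in> X \<Longrightarrow> dual_avg L \<gamma> x0 Gs k z \<le> dual_avg L \<gamma> x0 Gs k w"
  shows "dual_avg L \<gamma> x0 Gs k z + 1 / 2 * (norm (w - z))\<^sup>2 \<le> dual_avg L \<gamma> x0 Gs k w"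
proof -
  have "dual_avg L \<gamma> x0 Gs k = (\<lambda>w. (\<Sum>i=1..k. (weight L \<gamma> i / \<gamma>) *\<^sub>R Gs i) \<bullet> w
      + 1 / 2 * (norm (w - x0))\<^sup>2)"
    by (simp add: dual_avg_def inner_sum_left fun_eq_iff)
  with minimizer_quadratic[of X z w "\<Sum>i=1..k. (weight L \<gamma> i / \<gamma>) *\<^sub>R Gs i" 1 x0] assms
  show ?thesis
    by simp
qed

context prox_solver
begin

text \<open>Error per unit of weight. The first term collects nine \<delta> from the line search and
  one from \<open>quasar_bound\<close>, the second one gradient error from each. The last term
  bounds the accumulated errors proportional to \<open>A\<close>.\<close>

definition round_error :: "real \<Rightarrow> real \<Rightarrow> nat \<Rightarrow> real" where
  "round_error \<gamma> D k = 10 * \<delta> / \<gamma> + 2 * (sqrt (8 * L * \<delta>) * D) / \<gamma> + 6 * real k * \<delta>"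

text \<open>Three inequalities are added: the line search scaled by \<open>u\<close>, quasar
  convexity scaled by \<open>a\<close>, and strong convexity of psi at \<open>z\<close>. The terms
  in \<open>G x \<bullet> x\<close> cancel, and the squared gradient is absorbed by the gap between
  \<open>h x\<close> and \<open>f (pt x)\<close>.\<close>

lemma round_progress:
  fixes k :: nat and \<gamma> :: real and Gs x x0 z'
  defines "a \<equiv> weight L \<gamma> (Suc k)" and "A \<equiv> weight_sum L \<gamma> k"
    and "\<psi> \<equiv> dual_avg L \<gamma> x0 Gs k"
    and "\<psi>' \<equiv> dual_avg L \<gamma> x0 (Gs(Suc k := G x)) (Suc k)"
  assumes quasar: "quasar_convex_in d \<gamma> f X xs"
    and D: "\<And>x y. x \<in> X \<Longrightarrow> y \<in> X \<Longrightarrow> norm (x - y) \<le> D"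
    and mem: "y \<in> X" "z \<in> X" "x \<in> X" "z' \<in> X"
    and z: "\<And>w. w \<in> X \<Longrightarrow> \<psi> z \<le> \<psi> w"
    and search: "G x \<bullet> (x - z) \<le> A * \<gamma> / a * (h y - h x) + line_search_tol L \<delta> y z (A * \<gamma> / a)"
  shows "(A + a) * (f (pt x) - f xs) - A * (f y - f xs) \<le> \<psi>' z' - \<psi> z - a / \<gamma> * (G x \<bullet> xs)
    + a * (10 * \<delta> / \<gamma> + 2 * (sqrt (8 * L * \<delta>) * D) / \<gamma>) + 6 * A * \<delta>"
proof -
  have \<gamma>: "0 < \<gamma>" "\<gamma> \<le> 1" and xs: "xs \<in> X"
    using quasar by (auto simp: quasar_convex_in_def is_arg_min_linorder)
  define u where "u = a / \<gamma>"
  define Q where "Q = sqrt (8 * L * \<delta>) * D"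
  define r2 where "r2 = (norm (x - pt x))\<^sup>2"
  have a: "0 < a" and A: "0 \<le> A"
    using \<gamma> L_pos by (simp_all add: a_def A_def weight_def weight_sum_closed_form)
  have u: "0 < u" and au: "a = u * \<gamma>" and a_le_u: "a \<le> u"
    using a \<gamma> by (simp_all add: u_def field_simps)
  define c where "c = A * \<gamma> / a"
  \<comment> \<open>The line search parameter is chosen so that scaling by \<open>u\<close> puts the
    weight \<open>A\<close> on the function values.\<close>
  have uc: "u * c = A"
    using a \<gamma> by (simp add: u_def c_def)
  have "sqrt (8 * L * \<delta>) * norm (y - z) \<le> Q"
    unfolding Q_def using D mem L_pos \<delta>_pos by (intro mult_left_mono) auto
  then have "G x \<bullet> (x - z) \<le> c * (h y - h x) + Q + (9 + 5 * c) * \<delta>"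
    using search unfolding line_search_tol_def c_def by linarith
  then have "u * (G x \<bullet> (x - z)) \<le> u * (c * (h y - h x) + Q + (9 + 5 * c) * \<delta>)"
    using u by (intro mult_left_mono) auto
  also have "\<dots> = (u * c) * (h y - h x) + u * Q + 9 * u * \<delta> + 5 * (u * c) * \<delta>"
    by (simp add: algebra_simps)
  finally have "u * (G x \<bullet> (x - z)) \<le> A * (h y - h x) + u * Q + 9 * u * \<delta> + 5 * A * \<delta>"
    unfolding uc .
  moreover have "A * (h y - h x) \<le> A * (f y + \<delta> - (f (pt x) + L * r2))"
    using h_le_f[OF mem(1)] A
    by (intro mult_left_mono) (auto simp: h_def F_eq r2_def norm_minus_commute)
  ultimately have descent:
    "u * (G x \<bullet> x) - u * (G x \<bullet> z) \<le> A * f y - A * f (pt x) - A * L * r2 + u * Q + 9 * u * \<delta> + 6 * A * \<delta>"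
    by (simp add: algebra_simps)
  have "a * f xs \<ge> a * (f (pt x) + L * r2 - \<delta> + 1 / \<gamma> * (G x \<bullet> (xs - x)) - 1 / \<gamma> * Q)"
    using quasar_bound[OF quasar mem(3) D[OF xs mem(3)]] a
    by (intro mult_left_mono) (auto simp: r2_def Q_def)
  also have "a * (f (pt x) + L * r2 - \<delta> + 1 / \<gamma> * (G x \<bullet> (xs - x)) - 1 / \<gamma> * Q)
      = a * f (pt x) + a * L * r2 - a * \<delta> + u * (G x \<bullet> xs) - u * (G x \<bullet> x) - u * Q"
    by (simp add: u_def inner_diff_right algebra_simps add_divide_distrib diff_divide_distrib)
  finally have optimality:
    "a * f xs \<ge> a * f (pt x) + a * L * r2 - a * \<delta> + u * (G x \<bullet> xs) - u * (G x \<bullet> x) - u * Q" .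
  have "\<psi> z + 1 / 2 * (norm (z' - z))\<^sup>2 \<le> \<psi> z'"
    using dual_avg_strong_min[OF dom(3) mem(2,4)] z unfolding \<psi>_def by blast
  moreover have "\<psi>' z' = \<psi> z' + u * (G x \<bullet> z')"
    by (simp add: \<psi>'_def \<psi>_def dual_avg_Suc u_def a_def)
  \<comment> \<open>Young's inequality by completing the square.\<close>
  moreover have "1 / 2 * (norm (z' - z))\<^sup>2 + u * (G x \<bullet> z') \<ge> u * (G x \<bullet> z) - u\<^sup>2 / 2 * (norm (G x))\<^sup>2"
  proof -
    have "0 \<le> 1 / 2 * (norm ((z' - z) + u *\<^sub>R G x))\<^sup>2"
      by simp
    also have "\<dots> = 1 / 2 * (norm (z' - z))\<^sup>2 + u * (G x \<bullet> (z' - z)) + u\<^sup>2 / 2 * (norm (G x))\<^sup>2"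
      unfolding power2_norm_eq_inner inner_add_left inner_add_right
      by (simp add: inner_commute power2_eq_square field_simps)
    finally show ?thesis
      by (simp add: inner_diff_right algebra_simps)
  qed
  \<comment> \<open>This is where the linear growth of the weights enters: u^2 and
    \<open>A + a\<close> both grow like t^2, and the constants leave a factor of at least 2.\<close>
  moreover have "u\<^sup>2 / 2 * (norm (G x))\<^sup>2 \<le> (A + a) * L * r2"
  proof -
    define t where "t = real (Suc k)"
    have t: "1 \<le> t" and u_t: "u = \<gamma> * t / (8 * L)" and Aa: "A + a = \<gamma>\<^sup>2 * (t * (t + 1)) / (16 * L)"
      using \<gamma> weight_sum_closed_form[of L \<gamma> "Suc k"] unfolding weight_sum_Suc
      by (simp_all add: t_def u_def a_def A_def weight_def power2_eq_square)
    have "(norm (G x))\<^sup>2 = 4 * L\<^sup>2 * r2"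
      using L_pos by (simp add: G_def r2_def power_mult_distrib)
    then have "u\<^sup>2 / 2 * (norm (G x))\<^sup>2 = \<gamma>\<^sup>2 * t\<^sup>2 / 32 * r2"
      using L_pos by (simp add: u_t power2_eq_square)
    also have "\<dots> \<le> \<gamma>\<^sup>2 * (t * (t + 1)) / 16 * r2"
    proof -
      have "t * t \<le> 2 * (t * (t + 1))"
        using t by (simp add: algebra_simps)
      then have "\<gamma>\<^sup>2 * (t * t) \<le> \<gamma>\<^sup>2 * (2 * (t * (t + 1)))"
        by (intro mult_left_mono) auto
      then show ?thesis
        by (intro mult_right_mono) (auto simp: r2_def power2_eq_square)
    qed
    also have "\<dots> = (A + a) * L * r2"
      using L_pos by (simp add: Aa)
    finally show ?thesis .
  qed
  ultimately have mirror: "\<psi>' z' - \<psi> z \<ge> u * (G x \<bullet> z) - (A + a) * L * r2"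
    by linarith
  have "a * \<delta> \<le> u * \<delta>"
    using a_le_u \<delta>_pos by simp
  moreover have "a * (10 * \<delta> / \<gamma> + 2 * (sqrt (8 * L * \<delta>) * D) / \<gamma>) = 10 * (u * \<delta>) + 2 * (u * Q)"
    by (simp add: u_def Q_def add_divide_distrib distrib_left mult_ac)
  ultimately show ?thesis
    using descent optimality mirror unfolding u_def[symmetric] distrib_right right_diff_distrib
    by linarith
qed

text \<open>\<open>round_progress\<close> telescopes. The cost of a round is one line search plus
  \<open>N\<close> queries for solving again at the point found.\<close>

lemma rounds_invariant:
  assumes quasar: "quasar_convex_in d \<gamma> f X xs" and x0: "x0 \<in> X"
    and D: "\<And>x y. x \<in> X \<Longrightarrow> y \<in> X \<Longrightarrow> norm (x - y) \<le> D"
    and J: "sqrt (2 * L * \<delta>) * D \<le> 3 * \<delta> * 2 ^ J"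
  shows "\<exists>y z Gs q. rounds X L \<gamma> \<delta> N s x0 k orc = Some ((y, z, Gs), q) \<and> y \<in> X \<and> z \<in> X \<and>
    (\<forall>w\<in>X. dual_avg L \<gamma> x0 Gs k z \<le> dual_avg L \<gamma> x0 Gs k w) \<and>
    weight_sum L \<gamma> k * (f y - f xs) \<le> dual_avg L \<gamma> x0 Gs k z
      - (\<Sum>i=1..k. weight L \<gamma> i / \<gamma> * (Gs i \<bullet> xs)) + weight_sum L \<gamma> k * round_error \<gamma> D k \<and>
    q \<le> k * ((2 + J) * (N + 1) + N)"
proof (induction k)
  case 0
  show ?case
    using x0 by (auto simp: ret_def dual_avg_def weight_sum_def)
next
  case (Suc k)
  have \<gamma>: "0 < \<gamma>" "\<gamma> \<le> 1"
    using quasar by (auto simp: quasar_convex_in_def)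
  define a where "a = weight L \<gamma> (Suc k)"
  define A where "A = weight_sum L \<gamma> k"
  have a: "0 < a" and A: "0 \<le> A"
    using \<gamma> L_pos by (simp_all add: a_def A_def weight_def weight_sum_closed_form)
  have A': "weight_sum L \<gamma> (Suc k) = A + a"
    by (simp add: A_def a_def weight_sum_Suc)
  obtain y z Gs q where IH: "rounds X L \<gamma> \<delta> N s x0 k orc = Some ((y, z, Gs), q)" "y \<in> X" "z \<in> X"
    "\<forall>w\<in>X. dual_avg L \<gamma> x0 Gs k z \<le> dual_avg L \<gamma> x0 Gs k w"
    "A * (f y - f xs) \<le> dual_avg L \<gamma> x0 Gs k z
      - (\<Sum>i=1..k. weight L \<gamma> i / \<gamma> * (Gs i \<bullet> xs)) + A * round_error \<gamma> D k"
    "q \<le> k * ((2 + J) * (N + 1) + N)"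
    using Suc unfolding A_def by blast
  have "sqrt (2 * L * \<delta>) * norm (y - z) \<le> sqrt (2 * L * \<delta>) * D"
    using D[OF IH(2,3)] L_pos \<delta>_pos by (intro mult_left_mono) auto
  moreover have "0 \<le> A * \<gamma> / a"
    using a A \<gamma> by simp
  ultimately obtain x q1 where x: "binary_line_search X L \<delta> N s y z (A * \<gamma> / a) orc = Some (x, q1)"
    "x \<in> X" "G x \<bullet> (x - z) \<le> A * \<gamma> / a * (h y - h x) + line_search_tol L \<delta> y z (A * \<gamma> / a)"
    "q1 \<le> (2 + J) * (N + 1)"
    using binary_line_search_correct[OF IH(2,3), of "A * \<gamma> / a" J] J by auto
  define Gs' where "Gs' = Gs(Suc k := G x)"
  define z' where "z' = arg_min_on (dual_avg L \<gamma> x0 Gs' (Suc k)) X"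
  have "continuous_on X (dual_avg L \<gamma> x0 Gs' (Suc k))"
    unfolding dual_avg_def by (intro continuous_intros)
  note z' = arg_min_on_compact[OF dom(2) _ this, folded z'_def]
  have z'_mem: "z' \<in> X"
    using z'(1) x0 by auto
  have "(1 / lam L) *\<^sub>R (x - pt x) = G x"
    using L_pos by (simp add: G_def lam_def)
  then have run: "rounds X L \<gamma> \<delta> N s x0 (Suc k) orc = Some ((pt x, z', Gs'), q + (q1 + N))"
    using IH(1) x(1) prox_point_eq[of x]
    by (simp add: bind_comp_def ret_def Let_def A_def a_def z'_def Gs'_def dual_avg_def[abs_def]
        del: sum.cl_ivl_Suc cong: if_cong)
  have "(A + a) * (f (pt x) - f xs) - A * (f y - f xs) \<le>
    dual_avg L \<gamma> x0 Gs' (Suc k) z' - dual_avg L \<gamma> x0 Gs k z - a / \<gamma> * (G x \<bullet> xs)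
    + a * (10 * \<delta> / \<gamma> + 2 * (sqrt (8 * L * \<delta>) * D) / \<gamma>) + 6 * A * \<delta>"
    unfolding A_def a_def Gs'_def
    by (rule round_progress[OF quasar D]) (use IH x z'_mem in \<open>auto simp: A_def a_def\<close>)
  \<comment> \<open>The increase of \<open>round_error\<close> by 6 \<delta> per round pays for the
    summand \<open>6 * A * \<delta>\<close>.\<close>
  moreover have "a * (10 * \<delta> / \<gamma> + 2 * (sqrt (8 * L * \<delta>) * D) / \<gamma>) + 6 * A * \<delta> + A * round_error \<gamma> D k
      \<le> (A + a) * round_error \<gamma> D (Suc k)"
    using a \<delta>_pos by (simp add: round_error_def algebra_simps add_divide_distrib)
  moreover have "(\<Sum>i=1..Suc k. weight L \<gamma> i / \<gamma> * (Gs' i \<bullet> xs)) =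
      (\<Sum>i=1..k. weight L \<gamma> i / \<gamma> * (Gs i \<bullet> xs)) + a / \<gamma> * (G x \<bullet> xs)"
    by (simp add: Gs'_def a_def)
  ultimately have "(A + a) * (f (pt x) - f xs) \<le> dual_avg L \<gamma> x0 Gs' (Suc k) z'
      - (\<Sum>i=1..Suc k. weight L \<gamma> i / \<gamma> * (Gs' i \<bullet> xs)) + (A + a) * round_error \<gamma> D (Suc k)"
    using IH(5) by linarith
  moreover have "q + (q1 + N) \<le> Suc k * ((2 + J) * (N + 1) + N)"
    using IH(6) x(4) by simp
  ultimately show ?case
    using run pt(1)[OF x(2)] z'_mem z'(2) unfolding A'
    by (intro exI[of _ "pt x"] exI[of _ z'] exI[of _ Gs'] exI[of _ "q + (q1 + N)"]) auto
qed

lemma rounds_gap: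
  assumes quasar: "quasar_convex_in d \<gamma> f X xs" and x0: "x0 \<in> X"
    and D: "\<And>x y. x \<in> X \<Longrightarrow> y \<in> X \<Longrightarrow> norm (x - y) \<le> D"
    and J: "sqrt (2 * L * \<delta>) * D \<le> 3 * \<delta> * 2 ^ J"
  shows "\<exists>y z Gs q. rounds X L \<gamma> \<delta> N s x0 k orc = Some ((y, z, Gs), q) \<and> y \<in> X \<and>
    weight_sum L \<gamma> k * (f y - f xs) \<le> D\<^sup>2 / 2 + weight_sum L \<gamma> k * round_error \<gamma> D k \<and>
    q \<le> k * ((2 + J) * (N + 1) + N)"
proof -
  have xs: "xs \<in> X"
    using quasar by (auto simp: quasar_convex_in_def is_arg_min_linorder)
  obtain y z Gs q where run: "rounds X L \<gamma> \<delta> N s x0 k orc = Some ((y, z, Gs), q)" "y \<in> X"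
    "\<forall>w\<in>X. dual_avg L \<gamma> x0 Gs k z \<le> dual_avg L \<gamma> x0 Gs k w"
    "weight_sum L \<gamma> k * (f y - f xs) \<le> dual_avg L \<gamma> x0 Gs k z
      - (\<Sum>i=1..k. weight L \<gamma> i / \<gamma> * (Gs i \<bullet> xs)) + weight_sum L \<gamma> k * round_error \<gamma> D k"
    "q \<le> k * ((2 + J) * (N + 1) + N)"
    using rounds_invariant[OF assms, of k] by blast
  have "dual_avg L \<gamma> x0 Gs k z \<le> dual_avg L \<gamma> x0 Gs k xs"
    using run(3) xs by blast
  moreover have "(norm (xs - x0))\<^sup>2 \<le> D\<^sup>2"
    using D[OF xs x0] by (intro power_mono) auto
  ultimately have "weight_sum L \<gamma> k * (f y - f xs) \<le> D\<^sup>2 / 2 + weight_sum L \<gamma> k * round_error \<gamma> D k"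
    using run(4) by (simp add: dual_avg_def)
  with run show ?thesis
    by blast
qed

end

section \<open>Parameters and complexity\<close>

context smooth_domain
begin

text \<open>After \<open>Suc n\<close> steps the error is at most L D^2 (2/3)^n, so (2/3)^n must not
  exceed \<delta> / (L D^2). As ln (2/3) \<le> -1/3, three times the logarithm suffices; rounding up
  and the extra step raise the factor to 5, since the logarithm is at least 1.\<close>

lemma sufficient_iterations_exists:
  assumes D: "\<And>x y. x \<in> X \<Longrightarrow> y \<in> X \<Longrightarrow> norm (x - y) \<le> D" and "0 < \<delta>"
    and R: "3 \<le> L * D\<^sup>2 / \<delta>" and K: "5 \<le> K"
  shows "\<exists>N. sufficient_iterations K d f X L D \<delta> N"
proof -
  define R where "R = L * D\<^sup>2 / \<delta>"
  have R_pos: "0 < R"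
    using R by (simp add: R_def)
  define n where "n = nat \<lceil>3 * ln R\<rceil>"
  have "1 = ln (exp (1::real))"
    by simp
  also have "\<dots> \<le> ln R"
    using R exp_le by (subst ln_le_cancel_iff) (auto simp: R_def)
  finally have lnR: "1 \<le> ln R" .
  have n: "3 * ln R \<le> real n" "real n \<le> 3 * ln R + 1"
    using lnR unfolding n_def by linarith+
  have "ln (2 / 3) \<le> 2 / 3 - (1::real)"
    by (rule ln_le_minus_one) simp
  then have "real n * ln (2 / 3) \<le> real n * (- 1 / 3)"
    by (intro mult_left_mono) auto
  also have "\<dots> \<le> - ln R"
    using n(1) by simp
  finally have "exp (real n * ln (2 / 3)) \<le> exp (- ln R)"
    by simp
  moreover have "exp (real n * ln (2 / 3)) = (2 / 3) ^ n"
    unfolding exp_of_nat_mult by (subst exp_ln) auto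
  moreover have "exp (- ln R) = 1 / R"
    using R by (subst exp_minus, subst exp_ln) (auto simp: R_def inverse_eq_divide)
  ultimately have pow: "(2 / 3) ^ n \<le> 1 / R"
    by simp
  have "sufficient_iterations K d f X L D \<delta> (Suc n)"
    unfolding sufficient_iterations_def
  proof (intro conjI ballI)
    have "real (Suc n) \<le> 5 * ln R"
      using n(2) lnR by simp
    also have "\<dots> \<le> K * ln R"
      using K lnR by (intro mult_right_mono) auto
    finally show "real (Suc n) \<le> K * ln (L * D\<^sup>2 / \<delta>)"
      by (simp add: R_def)
  next
    fix x y0 assume x: "x \<in> X" and y0: "y0 \<in> X"
    have ne: "X \<noteq> {}"
      using x by auto
    obtain y where y: "pgd X L (Suc n) x y0 (first_order_oracle d f) = Some (y, Suc n)" "y \<in> X"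
      "F x y \<le> F x (prox x) + L * (2 / 3) ^ n * (norm (prox x - y0))\<^sup>2"
      using pgd_convergence[OF y0] by blast
    have "L * (2 / 3) ^ n * (norm (prox x - y0))\<^sup>2 \<le> L * (1 / R) * D\<^sup>2"
      using pow D[OF prox(1)[OF ne] y0] L_pos R_pos
      by (intro mult_mono power_mono) auto
    also have "\<dots> = \<delta>"
      using R L_pos \<open>0 < \<delta>\<close> by (auto simp: R_def)
    finally show "\<exists>y n'. pgd X L (Suc n) x y0 (first_order_oracle d f) = Some (y, n') \<and>
        approx_minimizer \<delta> (F x) X y"
      using y prox(3)[OF ne] by (auto simp: approx_minimizer_def simp del: pgd.simps)
  qed
  then show ?thesis ..
qed

end

section \<open>Arithmetic of the parameters for positive diameter\<close>

locale complexity_params =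
  fixes L \<gamma> \<epsilon> D :: real
  assumes L: "0 < L" and \<gamma>: "0 < \<gamma>" "\<gamma> \<le> 1" and \<epsilon>: "0 < \<epsilon>" and D: "0 < D"
begin

abbreviation T :: nat where
  "T \<equiv> num_rounds L \<gamma> \<epsilon> D"

abbreviation \<delta> :: real where
  "\<delta> \<equiv> tol L \<gamma> \<epsilon> D"

lemma num_rounds_bounds:
  "1 \<le> T" "4 / \<gamma> * sqrt (L * D\<^sup>2 / \<epsilon>) \<le> real T" "real T \<le> 4 / \<gamma> * sqrt (L * D\<^sup>2 / \<epsilon>) + 1"
proof -
  have "0 < 4 / \<gamma> * sqrt (L * D\<^sup>2 / \<epsilon>)"
    using L \<gamma> \<epsilon> D by simp
  then show "1 \<le> T" "4 / \<gamma> * sqrt (L * D\<^sup>2 / \<epsilon>) \<le> real T" "real T \<le> 4 / \<gamma> * sqrt (L * D\<^sup>2 / \<epsilon>) + 1"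
    unfolding num_rounds_def by linarith+
qed

lemma tol_pos: "0 < \<delta>"
  using L D num_rounds_bounds(1) by (simp add: tol_def)

lemma ratio_eq: "L * D\<^sup>2 / \<delta> = 10 * real T ^ 6"
  using L D num_rounds_bounds(1) by (simp add: tol_def)

lemma LD2_le: "L * D\<^sup>2 \<le> \<gamma>\<^sup>2 * \<epsilon> / 16 * (real T)\<^sup>2"
proof -
  have "(4 / \<gamma> * sqrt (L * D\<^sup>2 / \<epsilon>))\<^sup>2 \<le> (real T)\<^sup>2"
    using num_rounds_bounds(2) L \<gamma> \<epsilon> by (intro power_mono) auto
  moreover have "(4 / \<gamma> * sqrt (L * D\<^sup>2 / \<epsilon>))\<^sup>2 = 16 / \<gamma>\<^sup>2 * (L * D\<^sup>2 / \<epsilon>)"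
    using L \<epsilon> by (simp add: power_mult_distrib power_divide)
  ultimately have "16 / \<gamma>\<^sup>2 * (L * D\<^sup>2 / \<epsilon>) \<le> (real T)\<^sup>2"
    by simp
  then show ?thesis
    using \<gamma> \<epsilon> by (simp add: field_simps)
qed

lemma LD2_over_power_le:
  assumes "2 \<le> n"
  shows "L * D\<^sup>2 / real T ^ n \<le> \<gamma>\<^sup>2 * \<epsilon> / 16"
proof -
  have "(real T)\<^sup>2 \<le> real T ^ n"
    using num_rounds_bounds(1) assms by (intro power_increasing) auto
  then have "\<gamma>\<^sup>2 * \<epsilon> / 16 * (real T)\<^sup>2 \<le> \<gamma>\<^sup>2 * \<epsilon> / 16 * real T ^ n"
    using \<epsilon> by (intro mult_left_mono) auto
  with LD2_le show ?thesis
    using num_rounds_bounds(1) by (subst pos_divide_le_eq) auto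
qed

text \<open>The square root halves the exponent 6 in the tolerance, which still leaves T^3;
  \<open>LD2_over_power_le\<close> needs only T^2.\<close>

lemma gradient_error_le: "sqrt (8 * L * \<delta>) * D \<le> L * D\<^sup>2 / real T ^ 3"
proof -
  have "sqrt (8 * L * \<delta>) \<le> L * D / real T ^ 3"
  proof (rule real_le_lsqrt)
    show "8 * L * \<delta> \<le> (L * D / real T ^ 3)\<^sup>2"
      using L D num_rounds_bounds(1)
      by (simp add: tol_def power_divide power_mult_distrib power2_eq_square[of L]
          flip: power_mult)
        (simp add: field_simps)
  qed (use L D in auto)
  then have "sqrt (8 * L * \<delta>) * D \<le> L * D / real T ^ 3 * D"
    using D by (intro mult_right_mono) auto
  then show ?thesis
    by (simp add: power2_eq_square)
qed

text \<open>Half of \<epsilon> is spent on D^2 / (2 A_T) and the other half on inexactness. The last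
  \<delta> is for the final solve.\<close>

lemma total_error_le:
  "D\<^sup>2 / 2 + weight_sum L \<gamma> T *
      (10 * \<delta> / \<gamma> + 2 * (sqrt (8 * L * \<delta>) * D) / \<gamma> + 6 * real T * \<delta> + \<delta>)
    \<le> weight_sum L \<gamma> T * \<epsilon>"
proof -
  \<comment> \<open>The factor \<gamma>^2 leaves a bound of \<epsilon> / 16 even after a division by
    \<gamma>.\<close>
  define B where "B = \<gamma>\<^sup>2 * \<epsilon> / 16"
  have B: "B \<le> \<gamma> * (\<epsilon> / 16)" "\<gamma> * (\<epsilon> / 16) \<le> \<epsilon> / 16" "0 \<le> B"
    using \<gamma> \<epsilon> mult_mono[of \<gamma> 1 "\<gamma> * \<epsilon>" "\<gamma> * \<epsilon>"] by (auto simp: B_def power2_eq_square)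
  have over: "L * D\<^sup>2 / real T ^ n \<le> B" if "2 \<le> n" for n
    using LD2_over_power_le[OF that] by (simp add: B_def)
  have T: "1 \<le> real T"
    using num_rounds_bounds(1) by simp
  have "10 * \<delta> \<le> B"
    using over[of 6] by (simp add: tol_def)
  then have "10 * \<delta> / \<gamma> \<le> \<epsilon> / 16"
    using B \<gamma> by (simp add: field_simps)
  moreover have "sqrt (8 * L * \<delta>) * D \<le> B"
    using gradient_error_le over[of 3] by linarith
  then have "2 * (sqrt (8 * L * \<delta>) * D) / \<gamma> \<le> \<epsilon> / 8"
    using B \<gamma> by (simp add: field_simps)
  moreover have "real T * (10 * \<delta>) = L * D\<^sup>2 / real T ^ 5"
    using T by (simp add: tol_def power_numeral_reduce)
  then have "6 * real T * \<delta> \<le> \<epsilon> / 16"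
    using over[of 5] B by simp
  moreover have "\<delta> \<le> \<epsilon> / 16"
    using \<open>10 * \<delta> \<le> B\<close> B tol_pos by simp
  ultimately have errors:
    "10 * \<delta> / \<gamma> + 2 * (sqrt (8 * L * \<delta>) * D) / \<gamma> + 6 * real T * \<delta> + \<delta> \<le> \<epsilon> / 2"
    using \<epsilon> by linarith
  have "D\<^sup>2 / 2 \<le> weight_sum L \<gamma> T * (\<epsilon> / 2)"
  proof -
    have "L * D\<^sup>2 \<le> B * (real T)\<^sup>2"
      using LD2_le by (simp add: B_def)
    also have "\<dots> \<le> B * (real T * (real T + 1))"
      using B by (intro mult_left_mono) (auto simp: power2_eq_square distrib_left)
    finally show ?thesis
      using L by (simp add: weight_sum_closed_form B_def field_simps)
  qed
  moreover have "weight_sum L \<gamma> T *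
      (10 * \<delta> / \<gamma> + 2 * (sqrt (8 * L * \<delta>) * D) / \<gamma> + 6 * real T * \<delta> + \<delta>) \<le> weight_sum L \<gamma> T * (\<epsilon> / 2)"
    using L \<gamma> by (intro mult_left_mono[OF errors]) (simp add: weight_sum_closed_form)
  ultimately have "D\<^sup>2 / 2 + weight_sum L \<gamma> T *
      (10 * \<delta> / \<gamma> + 2 * (sqrt (8 * L * \<delta>) * D) / \<gamma> + 6 * real T * \<delta> + \<delta>)
    \<le> weight_sum L \<gamma> T * (\<epsilon> / 2) + weight_sum L \<gamma> T * (\<epsilon> / 2)"
    by (rule add_mono)
  then show ?thesis
    by (simp add: field_simps)
qed

text \<open>The ratio to be bounded by 2^J is of order T^3. With T < 2^(n+1) and 5 rounded up to 6
  this gives J = 3n + 4.\<close>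

lemma line_search_depth:
  "\<exists>J. sqrt (2 * L * \<delta>) * D \<le> 3 * \<delta> * 2 ^ J \<and> real J \<le> 4 + 6 * ln (real T)"
proof -
  obtain n where n: "2 ^ n \<le> T" "T < 2 ^ (n + 1)"
    using ex_power_ivl1[of 2 T] num_rounds_bounds(1) by auto
  then have "real (2 ^ n) \<le> real T" "real T \<le> real (2 ^ (n + 1))"
    unfolding of_nat_le_iff by simp_all
  then have T_le: "2 ^ n \<le> real T" "real T \<le> 2 ^ (n + 1)"
    unfolding of_nat_power of_nat_numeral .
  have T: "1 \<le> real T"
    using num_rounds_bounds(1) by simp
  have "sqrt (8 * L * \<delta>) = sqrt (2\<^sup>2 * (2 * L * \<delta>))"
    by simp
  also have "\<dots> = 2 * sqrt (2 * L * \<delta>)"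
    by (subst real_sqrt_mult) simp
  finally have "sqrt (2 * L * \<delta>) * D \<le> L * D\<^sup>2 / (2 * real T ^ 3)"
    using gradient_error_le by simp
  also have "\<dots> = 5 * \<delta> * real T ^ 3"
    using T by (simp add: tol_def power_numeral_reduce)
  also have "\<dots> \<le> 5 * \<delta> * (2 ^ (n + 1)) ^ 3"
    using T_le(2) tol_pos by (intro mult_left_mono power_mono) simp_all
  also have "\<dots> \<le> 6 * \<delta> * (2 ^ (n + 1)) ^ 3"
    using tol_pos by (intro mult_right_mono) auto
  also have "\<dots> = 3 * \<delta> * 2 ^ Suc ((n + 1) * 3)"
    by (simp only: power_mult power_Suc)
  also have "Suc ((n + 1) * 3) = 3 * n + 4"
    by simp
  finally have "sqrt (2 * L * \<delta>) * D \<le> 3 * \<delta> * 2 ^ (3 * n + 4)" .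
  moreover have "real n \<le> 2 * ln (real T)"
  proof -
    have "real n * (1 / 2) \<le> real n * ln 2"
      using ln2_ge_two_thirds by (intro mult_left_mono) auto
    also have "\<dots> = ln (2 ^ n)"
      by (simp add: ln_realpow)
    also have "\<dots> \<le> ln (real T)"
      using T_le(1) T by (subst ln_le_cancel_iff) auto
    finally show ?thesis
      by simp
  qed
  ultimately show ?thesis
    by (intro exI[of _ "3 * n + 4"]) simp
qed

text \<open>With \<open>Q\<close> the argument of the logarithm, Q \<ge> 3 gives T \<le> 5 Q^2 \<le>
  Q^4 and 10 \<le> Q^3; the constants 4 and 27 = 3 + 6 * 4 follow.\<close>

lemma log_factor:
  fixes l defines "l \<equiv> ln (2 + L * D\<^sup>2 / \<epsilon> + 1 / \<gamma>)"
  shows "1 \<le> l" "ln (real T) \<le> 4 * l" "ln (10 * real T ^ 6) \<le> 27 * l"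
proof -
  define R where "R = L * D\<^sup>2 / \<epsilon>"
  define Q where "Q = 2 + R + 1 / \<gamma>"
  have R: "0 < R" and inv: "1 \<le> 1 / \<gamma>"
    using L \<gamma> \<epsilon> D by (simp_all add: R_def)
  then have Q: "3 \<le> Q" "1 + R \<le> Q" "1 / \<gamma> \<le> Q"
    by (simp_all add: Q_def)
  have l: "l = ln Q"
    by (simp add: l_def Q_def R_def)
  have T: "1 \<le> real T"
    using num_rounds_bounds(1) by simp
  have "1 = ln (exp (1::real))"
    by simp
  also have "\<dots> \<le> ln Q"
    using Q(1) exp_le by (subst ln_le_cancel_iff) auto
  finally show l_ge: "1 \<le> l"
    by (simp add: l)
  have "sqrt R \<le> 1 + R"
    using R by (intro real_le_lsqrt) (auto simp: power2_eq_square algebra_simps)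
  then have "1 / \<gamma> * sqrt R \<le> Q * Q"
    using Q R inv by (intro mult_mono) auto
  moreover have "9 \<le> Q * Q"
    using Q(1) mult_mono[of 3 Q 3 Q] by simp
  ultimately have "real T \<le> 5 * (Q * Q)"
    using num_rounds_bounds(3) by (simp add: R_def)
  also have "\<dots> \<le> (Q * Q) * (Q * Q)"
    using \<open>9 \<le> Q * Q\<close> by (intro mult_right_mono) auto
  finally have "real T \<le> Q ^ 4"
    by (simp add: power_numeral_reduce algebra_simps)
  then have "ln (real T) \<le> ln (Q ^ 4)"
    using T Q by (subst ln_le_cancel_iff) auto
  also have "\<dots> = 4 * l"
    using Q by (simp add: ln_realpow l)
  finally show lnT: "ln (real T) \<le> 4 * l" .
  have "(3::real) ^ 3 \<le> Q ^ 3"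
    using Q by (intro power_mono) auto
  then have "ln 10 \<le> ln (Q ^ 3)"
    using Q by (subst ln_le_cancel_iff) auto
  also have "\<dots> = 3 * l"
    using Q by (simp add: ln_realpow l)
  finally show "ln (10 * real T ^ 6) \<le> 27 * l"
    using T lnT by (simp add: ln_mult ln_realpow)
qed

lemma total_queries_le:
  assumes K: "0 \<le> K" and N: "real N \<le> K * ln (L * D\<^sup>2 / \<delta>)"
    and J: "real J \<le> 4 + 6 * ln (real T)"
    and q: "q \<le> T * ((2 + J) * (N + 1) + N) + N"
  shows "real q \<le> 5 * (864 * K + 30) * max 1 (1 / \<gamma> * sqrt (L * D\<^sup>2 / \<epsilon>))
    * ln (2 + L * D\<^sup>2 / \<epsilon> + 1 / \<gamma>) ^ 2"
proof -
  define l where "l = ln (2 + L * D\<^sup>2 / \<epsilon> + 1 / \<gamma>)"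
  define M where "M = max 1 (1 / \<gamma> * sqrt (L * D\<^sup>2 / \<epsilon>))"
  note l = log_factor[folded l_def]
  have "K * ln (10 * real T ^ 6) \<le> K * (27 * l)"
    using K l by (intro mult_left_mono) auto
  then have N': "real N \<le> 27 * K * l"
    using N by (simp add: ratio_eq)
  have J': "2 + real J \<le> 30 * l"
    using J l by simp
  have "27 * K * l + 1 \<le> (27 * K + 1) * l"
    using l by (simp add: algebra_simps)
  with N' have "(2 + real J) * (real N + 1) \<le> (30 * l) * ((27 * K + 1) * l)"
    using J' l by (intro mult_mono) auto
  moreover have "27 * K * l \<le> 27 * K * l * l"
    using K l mult_left_mono[of 1 l "27 * K * l"] by simp
  \<comment> \<open>One logarithm comes from the bisections and one from \<open>N\<close>; 864 = 30
    * 27 + 2 * 27.\<close>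
  ultimately have round: "(2 + real J) * (real N + 1) + 2 * real N \<le> (864 * K + 30) * l\<^sup>2"
    using N' by (simp add: power2_eq_square algebra_simps)
  have T: "1 \<le> real T" "real T \<le> 5 * M"
    using num_rounds_bounds by (auto simp: M_def)
  have "real q \<le> real (T * ((2 + J) * (N + 1) + N) + N)"
    using q by (rule of_nat_mono)
  also have "\<dots> = real T * ((2 + real J) * (real N + 1) + real N) + 1 * real N"
    by (simp add: algebra_simps)
  \<comment> \<open>The final solve is charged once to every round, which is possible as T \<ge>
    1.\<close>
  also have "\<dots> \<le> real T * ((2 + real J) * (real N + 1) + real N) + real T * real N"
    using T by (intro add_left_mono mult_right_mono) auto
  also have "\<dots> = real T * ((2 + real J) * (real N + 1) + 2 * real N)"
    by (simp add: algebra_simps)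
  also have "\<dots> \<le> (5 * M) * ((864 * K + 30) * l\<^sup>2)"
    using T round by (intro mult_mono) auto
  finally show ?thesis
    unfolding l_def M_def by (simp only: mult_ac)
qed

end

text \<open>For diameter 0 the conventions for division and logarithm give T = 0 and \<delta> = 0
  and force N = 0. Hence nothing is queried and the start \<open>u\<close> is returned, the only
  point of \<open>X\<close>.\<close>

lemma algorithm_A_degenerate:
  assumes X: "X = {x0}" and K: "0 \<le> K" and \<epsilon>: "0 \<le> \<epsilon>" and u: "u \<in> X"
  shows "sufficient_iterations K d f X L 0 (tol L \<gamma> \<epsilon> 0) 0"
    and "sufficient_iterations K d f X L 0 (tol L \<gamma> \<epsilon> 0) N \<Longrightarrow>
      algorithm_A X 0 L \<gamma> \<epsilon> N s u x0 orc = Some (u, 0) \<and> f u - (INF x\<in>X. f x) \<le> \<epsilon>"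
proof -
  have [simp]: "num_rounds L \<gamma> \<epsilon> 0 = 0" "tol L \<gamma> \<epsilon> 0 = 0"
    by (simp_all add: num_rounds_def tol_def)
  show "sufficient_iterations K d f X L 0 (tol L \<gamma> \<epsilon> 0) 0"
    by (simp add: sufficient_iterations_def approx_minimizer_def X ret_def)
  show "algorithm_A X 0 L \<gamma> \<epsilon> N s u x0 orc = Some (u, 0) \<and> f u - (INF x\<in>X. f x) \<le> \<epsilon>"
    if "sufficient_iterations K d f X L 0 (tol L \<gamma> \<epsilon> 0) N"
    using that u \<epsilon> by (simp add: sufficient_iterations_def algorithm_A_def bind_comp_def ret_def X)
qed

section \<open>Correctness and complexity of the whole method\<close>

locale quasar_problem = smooth_domain + complexity_params +
  fixes xs :: rvec
  assumes quasar: "quasar_convex_in d \<gamma> f X xs"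
    and norm_diff_le: "\<And>x y. x \<in> X \<Longrightarrow> y \<in> X \<Longrightarrow> norm (x - y) \<le> D"
begin

lemma algorithm_A_correct:
  assumes x0: "x0 \<in> X" and s: "\<And>x. x \<in> X \<Longrightarrow> s x \<in> X" and u: "u \<in> X" and K: "0 \<le> K"
    and N: "sufficient_iterations K d f X L D \<delta> N"
  shows "\<exists>yhat q. algorithm_A X D L \<gamma> \<epsilon> N s u x0 (first_order_oracle d f) = Some (yhat, q) \<and>
    yhat \<in> X \<and> f yhat \<le> f xs + \<epsilon> \<and>
    real q \<le> 5 * (864 * K + 30) * max 1 (1 / \<gamma> * sqrt (L * D\<^sup>2 / \<epsilon>))
      * ln (2 + L * D\<^sup>2 / \<epsilon> + 1 / \<gamma>) ^ 2"
proof -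
  interpret prox_solver d X L f \<delta> N s
    by unfold_locales (use tol_pos N s in \<open>auto simp: sufficient_iterations_def\<close>)
  obtain J where J: "sqrt (2 * L * \<delta>) * D \<le> 3 * \<delta> * 2 ^ J" "real J \<le> 4 + 6 * ln (real T)"
    using line_search_depth by blast
  obtain y z Gs q where run: "rounds X L \<gamma> \<delta> N s x0 T orc = Some ((y, z, Gs), q)" "y \<in> X"
    "weight_sum L \<gamma> T * (f y - f xs) \<le> D\<^sup>2 / 2 + weight_sum L \<gamma> T * round_error \<gamma> D T"
    "q \<le> T * ((2 + J) * (N + 1) + N)"
    using rounds_gap[OF quasar x0 norm_diff_le J(1), of T] by blast
  have ne: "X \<noteq> {}"
    using x0 by auto
  obtain yhat n where final: "pgd X L N y u orc = Some (yhat, n)" "approx_minimizer \<delta> (F y) X yhat"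
    using N run(2) u unfolding sufficient_iterations_def by blast
  have n: "n = N"
    using final(1) pgd_terminates[of X L N y u orc] by auto
  \<comment> \<open>Testing with \<open>y\<close> itself, where the proximal term vanishes, shows
    that the final solve raises \<open>f\<close> by at most \<delta>.\<close>
  have yhat: "yhat \<in> X" "F y yhat \<le> F y y + \<delta>"
    using final(2) prox(2)[OF ne run(2), of y] by (auto simp: approx_minimizer_def prox(3)[OF ne])
  have "0 \<le> L * (norm (yhat - y))\<^sup>2"
    using L_pos by simp
  then have "f yhat \<le> f y + \<delta>"
    using yhat(2) by (simp add: F_eq)
  have pos: "0 < weight_sum L \<gamma> T"
    using num_rounds_bounds(1) L \<gamma> by (simp add: weight_sum_closed_form)
  have "weight_sum L \<gamma> T * (f y - f xs + \<delta>) \<le> weight_sum L \<gamma> T * \<epsilon>"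
    using run(3) total_error_le by (simp add: round_error_def distrib_left)
  then have "f y - f xs + \<delta> \<le> \<epsilon>"
    using pos by simp
  with \<open>f yhat \<le> f y + \<delta>\<close> have "f yhat \<le> f xs + \<epsilon>"
    by simp
  moreover have "algorithm_A X D L \<gamma> \<epsilon> N s u x0 orc = Some (yhat, q + N)"
    using run(1) final(1) n by (simp add: algorithm_A_def bind_comp_def)
  moreover have "real (q + N) \<le> 5 * (864 * K + 30) * max 1 (1 / \<gamma> * sqrt (L * D\<^sup>2 / \<epsilon>))
      * ln (2 + L * D\<^sup>2 / \<epsilon> + 1 / \<gamma>) ^ 2"
    using total_queries_le[OF K _ J(2), of N "q + N"] N run(4) by (simp add: sufficient_iterations_def)
  ultimately show ?thesis
    using yhat(1) by blast
qed

end

text \<open>\<open>K\<close> is the constant hidden in the iteration bound: it must be large enough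
  for a sufficient number to exist, and \<open>C\<close> and \<open>k\<close> depend on it alone,
  not on the dimension or the problem.\<close>

theorem theorem5:
  shows "\<exists>K0>0. \<forall>K\<ge>K0. \<exists>(C::real) (k::nat).
    \<forall>(d::nat) X D L \<gamma> \<epsilon> f xs x0 s u.
      X \<subseteq> euclid d \<longrightarrow> compact X \<longrightarrow> convex X \<longrightarrow> D = diameter X \<longrightarrow>
      0 < L \<longrightarrow> 0 < \<gamma> \<longrightarrow> \<gamma> \<le> 1 \<longrightarrow> 0 < \<epsilon> \<longrightarrow>
      smooth_in d L f X \<longrightarrow> xs \<in> X \<longrightarrow> quasar_convex_in d \<gamma> f X xs \<longrightarrow>
      x0 \<in> X \<longrightarrow> (\<forall>x\<in>X. s x \<in> X) \<longrightarrow> u \<in> X \<longrightarrow>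
      (\<exists>N. sufficient_iterations K d f X L D (tol L \<gamma> \<epsilon> D) N) \<and>
      (\<forall>N. sufficient_iterations K d f X L D (tol L \<gamma> \<epsilon> D) N \<longrightarrow>
        (\<exists>yhat q.
          algorithm_A X D L \<gamma> \<epsilon> N s u x0 (first_order_oracle d f) = Some (yhat, q) \<and>
          yhat \<in> X \<and>
          f yhat - (INF x\<in>X. f x) \<le> \<epsilon> \<and>
          real q \<le> C * max 1 (1 / \<gamma> * sqrt (L * D\<^sup>2 / \<epsilon>))
                     * ln (2 + L * D\<^sup>2 / \<epsilon> + 1 / \<gamma>) ^ k))"
proof (rule exI[of _ 5], intro conjI allI impI)
  fix K :: real assume K: "5 \<le> K"
  show "\<exists>(C::real) (k::nat).
    \<forall>(d::nat) X D L \<gamma> \<epsilon> f xs x0 s u.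
      X \<subseteq> euclid d \<longrightarrow> compact X \<longrightarrow> convex X \<longrightarrow> D = diameter X \<longrightarrow>
      0 < L \<longrightarrow> 0 < \<gamma> \<longrightarrow> \<gamma> \<le> 1 \<longrightarrow> 0 < \<epsilon> \<longrightarrow>
      smooth_in d L f X \<longrightarrow> xs \<in> X \<longrightarrow> quasar_convex_in d \<gamma> f X xs \<longrightarrow>
      x0 \<in> X \<longrightarrow> (\<forall>x\<in>X. s x \<in> X) \<longrightarrow> u \<in> X \<longrightarrow>
      (\<exists>N. sufficient_iterations K d f X L D (tol L \<gamma> \<epsilon> D) N) \<and>
      (\<forall>N. sufficient_iterations K d f X L D (tol L \<gamma> \<epsilon> D) N \<longrightarrow>
        (\<exists>yhat q.
          algorithm_A X D L \<gamma> \<epsilon> N s u x0 (first_order_oracle d f) = Some (yhat, q) \<and>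
          yhat \<in> X \<and>
          f yhat - (INF x\<in>X. f x) \<le> \<epsilon> \<and>
          real q \<le> C * max 1 (1 / \<gamma> * sqrt (L * D\<^sup>2 / \<epsilon>))
                     * ln (2 + L * D\<^sup>2 / \<epsilon> + 1 / \<gamma>) ^ k))"
  proof (rule exI[of _ "5 * (864 * K + 30)"], rule exI[of _ 2], intro allI impI)
    fix d X and D L \<gamma> \<epsilon> :: real and f xs x0 s u
    assume dom: "X \<subseteq> euclid d" "compact X" "convex X" and D: "D = diameter X"
      and params: "0 < L" "0 < \<gamma>" "\<gamma> \<le> 1" "0 < \<epsilon>"
      and smooth: "smooth_in d L f X" and quasar: "quasar_convex_in d \<gamma> f X xs"
      and pts: "xs \<in> X" "x0 \<in> X" "\<forall>x\<in>X. s x \<in> X" "u \<in> X"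
    interpret smooth_domain d X L f
      using dom params smooth by unfold_locales
    have bounded: "norm (x - y) \<le> D" if "x \<in> X" "y \<in> X" for x y
      using diameter_bounded_bound[OF compact_imp_bounded[OF dom(2)] that] by (simp add: D dist_norm)
    have Inf: "(INF x\<in>X. f x) = f xs"
      using quasar by (intro cInf_eq_minimum) (auto simp: quasar_convex_in_def is_arg_min_linorder)
    let ?C = "5 * (864 * K + 30) * max 1 (1 / \<gamma> * sqrt (L * D\<^sup>2 / \<epsilon>))
      * ln (2 + L * D\<^sup>2 / \<epsilon> + 1 / \<gamma>) ^ 2"
    show "(\<exists>N. sufficient_iterations K d f X L D (tol L \<gamma> \<epsilon> D) N) \<and>
      (\<forall>N. sufficient_iterations K d f X L D (tol L \<gamma> \<epsilon> D) N \<longrightarrow>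
        (\<exists>yhat q.
          algorithm_A X D L \<gamma> \<epsilon> N s u x0 (first_order_oracle d f) = Some (yhat, q) \<and>
          yhat \<in> X \<and>
          f yhat - (INF x\<in>X. f x) \<le> \<epsilon> \<and>
          real q \<le> ?C))"
    proof (cases "D = 0")
      case True
      then have X: "X = {x0}"
        using bounded pts(2) by fastforce
      have "0 \<le> ?C"
        using K by (intro mult_nonneg_nonneg) auto
      then show ?thesis
        using algorithm_A_degenerate[OF X, of K \<epsilon> u] K params pts True by fastforce
    next
      case False
      then have "0 < D"
        using bounded[OF pts(2,2)] by simp
      then interpret quasar_problem d X L f \<gamma> \<epsilon> D xs
        using params quasar bounded by unfold_locales auto
      \<comment> \<open>This makes the ratio of L D^2 to \<delta> at least 10, as
        \<open>sufficient_iterations_exists\<close> requires at least 3.\<close>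
      have "1 \<le> real T ^ 6"
        using num_rounds_bounds(1) by simp
      then show ?thesis
        using sufficient_iterations_exists[of D "tol L \<gamma> \<epsilon> D" K] bounded tol_pos K
          algorithm_A_correct[of x0 s u K] pts
        by (auto simp: ratio_eq Inf algebra_simps)
    qed
  qed
qed simp

end
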